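(* Let $n\in\mathbb{N}$ and let $\mathfrak{N}$ be the class of non-degenerate ReLU networks with rational weights and biases, with $n$ input nodes, realizing functions $f:[0,1]^n\to[0,1]$. The set of axioms $\mathcal{DMV}$ completely identifies $\mathfrak{N}$ over $[0,1]^n$, that is: for all $\mathcal{N}_1,\mathcal{N}_2\in\mathfrak{N}$, if $\langle\mathcal{N}_1\rangle(x)=\langle\mathcal{N}_2\rangle(x)$ for all $x\in[0,1]^n$, then $\mathcal{N}_1\overset{\mathcal{DMV}}{\sim}\mathcal{N}_2$, i.e. the Rational Łukasiewicz formula $[\mathrm{ext}(\mathcal{N}_2)]$ is derivable from $[\mathrm{ext}(\mathcal{N}_1)]$ in finitely many steps by application of the axioms $\mathcal{DMV}$.
   Context: **Layered graphs and networks.** A layered graph of depth $L\ge1$ and architecture $(d_0,\dots,d_L)$, $d_L=1$, $d_j\ge 1$, has nodes partitioned into levels $V^{(j)}=\{v^{(j)}_1,\dots,v^{(j)}_{d_j}\}$, $j=0,\dots,L$, $V^{(L)}=\{v_{\rm out}\}$, with edges exactly all pairs (node of level $j-1$, node of level $j$), $j=1,\dots,L$. A neural network is a layered graph with a weight $w_{v,u}\in\mathbb{R}$ on each edge $(u,v)$ (possibly zero), a bias $b_v$ at each non-input node, and activation functions. $V^{(0)}$ are input nodes; nodes at levels $1,\dots,L-1$ are hidden. In a ReLU network ($\rho$-network) all hidden nodes have activation $\rho(t)=\max\{t,0\}$ and the output node has none; in a $\sigma$-network all non-input nodes (output included) have activation $\sigma(t)=\max\{\min\{t,1\},0\}$.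 The local map $\langle v\rangle$ of a node at level $j\ge 1$ is $x\mapsto\psi_v(\sum_{i'}w_{v,v^{(j-1)}_{i'}}x_{i'}+b_v)$, $x\in\mathbb{R}^{d_{j-1}}$ ($\psi_v$ the activation, or identity if none), and $\langle v_i^{(0)}\rangle(x)=x_i$. The global map $\langle\!\langle v\rangle\!\rangle:\mathbb{R}^{d_0}\to\mathbb{R}$ is obtained by composing local maps from the inputs on, and $\langle\mathcal{N}\rangle=\langle\!\langle v_{\rm out}\rangle\!\rangle$. "Realizing a function $[0,1]^n\to[0,1]$" means $d_0=n$ and $\langle\mathcal N\rangle([0,1]^n)\subseteq[0,1]$. **Non-degenerate.** A ReLU network is non-degenerate (on $[0,1]^{d_0}$) if: every hidden node $v$ satisfies $\langle\!\langle v\rangle\!\rangle(x)>0$ for some $x\in[0,1]^{d_0}$; every hidden node satisfies $\langle\!\langle v\rangle\!\rangle(x)=0$ for some $x\in[0,1]^{d_0}$; no two nodes at the same level have the same local map; every hidden node has at least one nonzero outgoing weight. **Formulae.** A Rational Łukasiewicz formula is a finite string built from propositional variables $x_1,x_2,\dots$, constants $0,1$, binary connectives $\oplus,\odot$, and unary connectives $\lnot$ and $\delta_i$ ($i\in\mathbb{N}=\{1,2,\dots\}$). Its truth function is obtained by evaluating in $\mathbb{I}_D$, i.e. on $[0,1]$ with $x\oplus y=\min\{1,x+y\}$, $x\odot y=\max\{0,x+y-1\}$, $\lnot x=1-x$, $\delta_ix=x/i$. **Axioms.** $\mathcal{MV}$ consists of: $x\oplus y=y\oplus x$; $x\odot y=y\odot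 x$; $x\oplus(y\oplus z)=(x\oplus y)\oplus z$; $x\odot(y\odot z)=(x\odot y)\odot z$; $x\oplus\lnot x=1$; $x\odot\lnot x=0$; $x\oplus1=1$; $x\odot0=0$; $x\oplus0=x$; $x\odot1=x$; $\lnot(x\oplus y)=\lnot x\odot\lnot y$; $\lnot(x\odot y)=\lnot x\oplus\lnot y$; $x=\lnot(\lnot x)$; $\lnot0=1$; $(x\odot\lnot y)\oplus y=(y\odot\lnot x)\oplus x$; $(x\oplus\lnot y)\odot y=(y\oplus\lnot x)\odot x$. $\mathcal{DMV}$ is $\mathcal{MV}$ together with $\oplus^n\delta_nx=x$ and $\delta_nx\odot(\oplus^{n-1}\delta_nx)=0$ for all $n\in\mathbb{N}$, where $\oplus^j$ denotes $j$-fold disjunction (fixed bracketing; the empty one is $0$). **Derivation.** An equation $\gamma=\gamma'$ instantiates an axiom $\epsilon=\epsilon'$ if, for some substitution of formulae for variables applied to both sides, it becomes $\gamma=\gamma'$ or $\gamma'=\gamma$. A derivation step replaces one occurrence of a subformula $\gamma$ by $\gamma'$ where $\gamma=\gamma'$ instantiates an axiom. $\tau\overset{\mathcal{DMV}}{\sim}\tau'$ means $\tau'$ is reached from $\tau$ by finitely many (possibly zero) steps using axioms of $\mathcal{DMV}$. **Substitution graphs.** A substitution graph is a layered graph with a formula $[v]$ at each node: $[v_i^{(0)}]=x_i$, and a node at level $j\ge1$ carries a formula in the variables $x_1,\dots,x_{d_{j-1}}$, $x_{i'}$ referring to the parent $v^{(j-1)}_{i'}$. The represented formula $[\mathcal{G}]$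 is obtained from $[v_{\rm out}]$ by simultaneously replacing each $x_{i'}$ by $[v_{i'}^{(L-1)}]$, then in the result each $x_{i'}$ by $[v_{i'}^{(L-2)}]$, and so on down to level $0$. **Extraction (rational version).** For a ReLU network $\mathcal{N}$ with rational weights and biases and $[0,1]$-valued on $[0,1]^{d_0}$, $\mathrm{ext}(\mathcal{N})$ is defined as follows. *Step I.* For $j=1,\dots,L-1$ in this order, for each node $v$ of level $j$ compute $\mathcal{L}_v=b_v+\sum_u\max\{w_{v,u},0\}$ over its (already converted) parents $u$. If $\mathcal{L}_v\le1$, replace its activation by $\sigma$; if $\mathcal{L}_v>1$, replace $v$ by $\lceil\mathcal{L}_v\rceil$ $\sigma$-nodes with the same incoming and outgoing weights and biases $b_v,b_v-1,\dots,b_v-\lceil\mathcal{L}_v\rceil+1$ (nodes of each new level enumerated in a fixed order). Finally apply $\sigma$ at the output node. *Step II.* Each input node gets $x_i$. For a non-input node with local map $\sigma(f)$, let $s$ be the least common multiple of the denominators of the coefficients and constant term of $f$; the node gets the formula $\bigoplus_{i=0}^{s-1}\delta_s\tau_i$ with $\tau_i=\mathtt{EXTR}(\sigma(sf-i))$ (fixed bracketing). Here, for $f=m_1x_1+\dots+m_nx_n+b$ with integer coefficients, with min $\ell$ and max $\mathcal{L}$ over $[0,1]^n$, $\mathtt{EXTR}(\sigma(f))$ is: $1$ if $\ell\ge1$; $0$ if $\mathcal{L}\le0$; otherwise let $k$ be the smallest index with $m_k\ne0$; if $m_k\ge1$ it is $(\mathtt{EXTR}(\sigma(f-x_k))\oplus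 x_k)\odot\mathtt{EXTR}(\sigma(f-x_k+1))$; if $m_k\le-1$ it is $\lnot\,\mathtt{EXTR}(\sigma(1-f))$; occurrences $0\oplus\tau$ and $\tau\odot1$ produced by the recursion are simplified to $\tau$. $\mathrm{ext}(\mathcal N)$ is the layered graph of the $\sigma$-network from Step I with the node formulae of Step II. **Network derivation.** $\mathcal{N}_1\overset{\mathcal{DMV}}{\sim}\mathcal{N}_2$ means $[\mathrm{ext}(\mathcal{N}_1)]\overset{\mathcal{DMV}}{\sim}[\mathrm{ext}(\mathcal{N}_2)]$. *)

theory Defs
  imports Complex_Main
begin

section \<open>Rational Lukasiewicz formulae and derivations\<close>

text \<open>Variables are counted from 0, so \<open>Var i\<close> is the propositional variable written
  \<open>x\<close> with subscript \<open>i + 1\<close> on paper. The connectives \<open>\<delta>\<close> are indexed by positive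
  integers, so \<open>DeltaSuc k\<close> is \<open>\<delta>\<close> with index \<open>k + 1\<close>.\<close>

datatype formula =
    Var nat
  | Zero
  | One
  | Oplus formula formula  (infixl \<open>\<oplus>\<close> 65)
  | Odot formula formula  (infixl \<open>\<odot>\<close> 70)
  | Neg formula
  | DeltaSuc nat formula

text \<open>The bracketing of iterated disjunctions is to the right; a one-element disjunction is
  the disjunct itself.\<close>

fun big_oplus :: "formula list \<Rightarrow> formula" where
  "big_oplus [] = Zero"
| "big_oplus [t] = t"
| "big_oplus (t # u # ts) = t \<oplus> big_oplus (u # ts)"

primrec subst :: "(nat \<Rightarrow> formula) \<Rightarrow> formula \<Rightarrow> formula" where
  "subst s (Var i) = s i"
| "subst s Zero = Zero"
| "subst s One = One"
| "subst s (t \<oplus> u) = subst s t \<oplus> subst s u"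
| "subst s (t \<odot> u) = subst s t \<odot> subst s u"
| "subst s (Neg t) = Neg (subst s t)"
| "subst s (DeltaSuc k t) = DeltaSuc k (subst s t)"

definition MV :: "(formula \<times> formula) set" where
  "MV = (let x = Var 0; y = Var 1; z = Var 2 in
    {(x \<oplus> y, y \<oplus> x),
     (x \<odot> y, y \<odot> x),
     (x \<oplus> (y \<oplus> z), (x \<oplus> y) \<oplus> z),
     (x \<odot> (y \<odot> z), (x \<odot> y) \<odot> z),
     (x \<oplus> Neg x, One),
     (x \<odot> Neg x, Zero),
     (x \<oplus> One, One),
     (x \<odot> Zero, Zero),
     (x \<oplus> Zero, x),
     (x \<odot> One, x),
     (Neg (x \<oplus> y), Neg x \<odot> Neg y),
     (Neg (x \<odot> y), Neg x \<oplus> Neg y),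
     (x, Neg (Neg x)),
     (Neg Zero, One),
     ((x \<odot> Neg y) \<oplus> y, (y \<odot> Neg x) \<oplus> x),
     ((x \<oplus> Neg y) \<odot> y, (y \<oplus> Neg x) \<odot> x)})"

text \<open>The additional axioms for the connective \<open>\<delta>\<close> with index \<open>n = k + 1\<close>.\<close>

definition DMV :: "(formula \<times> formula) set" where
  "DMV = MV
    \<union> {(big_oplus (replicate (Suc k) (DeltaSuc k (Var 0))), Var 0) | k. True}
    \<union> {(DeltaSuc k (Var 0) \<odot> big_oplus (replicate k (DeltaSuc k (Var 0))), Zero) | k. True}"

definition instantiates :: "formula \<times> formula \<Rightarrow> formula \<times> formula \<Rightarrow> bool" where
  "instantiates eq ax \<longleftrightarrow>
    (\<exists>s. (subst s (fst ax), subst s (snd ax)) = eq \<or> (subst s (snd ax), subst s (fst ax)) = eq)"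

inductive deriv_step :: "(formula \<times> formula) set \<Rightarrow> formula \<Rightarrow> formula \<Rightarrow> bool"
  for Ax where
  replace: "ax \<in> Ax \<Longrightarrow> instantiates (t, t') ax \<Longrightarrow> deriv_step Ax t t'"
| oplus_left: "deriv_step Ax t t' \<Longrightarrow> deriv_step Ax (t \<oplus> u) (t' \<oplus> u)"
| oplus_right: "deriv_step Ax t t' \<Longrightarrow> deriv_step Ax (u \<oplus> t) (u \<oplus> t')"
| odot_left: "deriv_step Ax t t' \<Longrightarrow> deriv_step Ax (t \<odot> u) (t' \<odot> u)"
| odot_right: "deriv_step Ax t t' \<Longrightarrow> deriv_step Ax (u \<odot> t) (u \<odot> t')"
| neg: "deriv_step Ax t t' \<Longrightarrow> deriv_step Ax (Neg t) (Neg t')"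
| delta: "deriv_step Ax t t' \<Longrightarrow> deriv_step Ax (DeltaSuc k t) (DeltaSuc k t')"

definition derivable :: "(formula \<times> formula) set \<Rightarrow> formula \<Rightarrow> formula \<Rightarrow> bool" where
  "derivable Ax = (deriv_step Ax)\<^sup>*\<^sup>*"


section \<open>Layered neural networks\<close>

text \<open>The edges of a layered graph are determined by its levels, so a network is given by the
  number of input nodes and the lists of nodes at levels 1, 2, ..., the last one being the
  output level. Entry \<open>i\<close> of \<open>weights v\<close> is the weight on the edge from the \<open>i\<close>-th node of
  the preceding level to \<open>v\<close>. A node without activation function has \<open>act = id\<close>.\<close>

record node =
  act :: "real \<Rightarrow> real"
  weights :: "real list"
  bias :: real

record network =
  input_dim :: nat
  layers :: "node list list"

definition relu :: "real \<Rightarrow> real" where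
  "relu t = max t 0"

definition clip :: "real \<Rightarrow> real" where
  "clip t = max (min t 1) 0"

definition depth :: "network \<Rightarrow> nat" where
  "depth N = length (layers N)"

text \<open>\<open>level N j\<close> is meant for \<open>1 \<le> j \<le> depth N\<close>; input nodes carry no data.\<close>

definition level :: "network \<Rightarrow> nat \<Rightarrow> node list" where
  "level N j = layers N ! (j - 1)"

definition width :: "network \<Rightarrow> nat \<Rightarrow> nat" where
  "width N j = (if j = 0 then input_dim N else length (level N j))"

definition is_network :: "network \<Rightarrow> bool" where
  "is_network N \<longleftrightarrow>
    depth N \<ge> 1 \<and> width N (depth N) = 1 \<and> (\<forall>j\<le>depth N. width N j \<ge> 1) \<and>
    (\<forall>j\<in>{1..depth N}. \<forall>v\<in>set (level N j). length (weights v) = width N (j - 1))"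

definition relu_network :: "network \<Rightarrow> bool" where
  "relu_network N \<longleftrightarrow> is_network N \<and>
    (\<forall>j\<in>{1..<depth N}. \<forall>v\<in>set (level N j). act v = relu) \<and>
    (\<forall>v\<in>set (level N (depth N)). act v = id)"

definition rational_network :: "network \<Rightarrow> bool" where
  "rational_network N \<longleftrightarrow>
    (\<forall>j\<in>{1..depth N}. \<forall>v\<in>set (level N j). set (weights v) \<subseteq> \<rat> \<and> bias v \<in> \<rat>)"

definition local_map :: "node \<Rightarrow> real list \<Rightarrow> real" where
  "local_map v x = act v ((\<Sum>i<length (weights v). weights v ! i * x ! i) + bias v)"

definition level_values :: "network \<Rightarrow> nat \<Rightarrow> real list \<Rightarrow> real list" where
  "level_values N j x = fold (\<lambda>l y. map (\<lambda>v. local_map v y) l) (take j (layers N)) x"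

definition global_map :: "network \<Rightarrow> nat \<Rightarrow> node \<Rightarrow> real list \<Rightarrow> real" where
  "global_map N j v x = local_map v (level_values N (j - 1) x)"

definition realization :: "network \<Rightarrow> real list \<Rightarrow> real" where
  "realization N = global_map N (depth N) (hd (level N (depth N)))"

definition cube :: "nat \<Rightarrow> real list set" where
  "cube n = {x. length x = n \<and> set x \<subseteq> {0..1}}"

text \<open>In the third condition, level 0 is omitted since the local maps of the input nodes are the
  coordinate functions, which are distinct.\<close>

definition nondegenerate :: "network \<Rightarrow> bool" where
  "nondegenerate N \<longleftrightarrow>
    (\<forall>j\<in>{1..<depth N}. \<forall>v\<in>set (level N j). \<exists>x\<in>cube (input_dim N). global_map N j v x > 0) \<and>
    (\<forall>j\<in>{1..<depth N}. \<forall>v\<in>set (level N j). \<exists>x\<in>cube (input_dim N). global_map N j v x = 0) \<and>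
    (\<forall>j\<in>{1..depth N}. \<forall>i<width N j. \<forall>i'<width N j. i \<noteq> i' \<longrightarrow>
      \<not> (\<forall>x. length x = width N (j - 1) \<longrightarrow>
            local_map (level N j ! i) x = local_map (level N j ! i') x)) \<and>
    (\<forall>j\<in>{1..<depth N}. \<forall>i<width N j. \<exists>v\<in>set (level N (j + 1)). weights v ! i \<noteq> 0)"

definition nondegenerate_rational_networks :: "nat \<Rightarrow> network set" where
  "nondegenerate_rational_networks n =
    {N. relu_network N \<and> rational_network N \<and> nondegenerate N \<and>
        input_dim N = n \<and> realization N ` cube n \<subseteq> {0..1}}"


section \<open>Extraction of formulae\<close>

subsection \<open>Step I: conversion into a network with clipped activations\<close>

definition node_bound :: "node \<Rightarrow> real" where
  "node_bound v = bias v + (\<Sum>w\<leftarrow>weights v. max w 0)"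

definition copies :: "node \<Rightarrow> nat" where
  "copies v = (if node_bound v \<le> 1 then 1 else nat \<lceil>node_bound v\<rceil>)"

definition split_node :: "node \<Rightarrow> node list" where
  "split_node v = map (\<lambda>i. v\<lparr>act := clip, bias := bias v - real i\<rparr>) [0..<copies v]"

text \<open>Adapts the incoming weights of a node to the replacement of its \<open>i\<close>-th parent by \<open>ks ! i\<close>
  copies, which are listed consecutively in the new level.\<close>

definition expand_weights :: "nat list \<Rightarrow> node \<Rightarrow> node" where
  "expand_weights ks v = v\<lparr>weights := concat (map2 replicate ks (weights v))\<rparr>"

fun clip_layers :: "nat list \<Rightarrow> node list list \<Rightarrow> node list list" where
  "clip_layers ks [] = []"
| "clip_layers ks [l] = [map (\<lambda>v. (expand_weights ks v)\<lparr>act := clip\<rparr>) l]"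
| "clip_layers ks (l # l' # ls) =
    (let vs = map (expand_weights ks) l
     in concat (map split_node vs) # clip_layers (map copies vs) (l' # ls))"

definition clip_network :: "network \<Rightarrow> network" where
  "clip_network N = N\<lparr>layers := clip_layers (replicate (input_dim N) 1) (layers N)\<rparr>"

subsection \<open>Step II: formulae of the nodes\<close>

definition oplus_simp :: "formula \<Rightarrow> formula \<Rightarrow> formula" where
  "oplus_simp t u = (if t = Zero then u else t \<oplus> u)"

definition odot_simp :: "formula \<Rightarrow> formula \<Rightarrow> formula" where
  "odot_simp t u = (if u = One then t else t \<odot> u)"

definition affine :: "int list \<Rightarrow> int \<Rightarrow> real list \<Rightarrow> real" where
  "affine ms b x = (\<Sum>i<length ms. of_int (ms ! i) * x ! i) + of_int b"

definition affine_min :: "int list \<Rightarrow> int \<Rightarrow> real" where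
  "affine_min ms b = Inf (affine ms b ` cube (length ms))"

definition affine_max :: "int list \<Rightarrow> int \<Rightarrow> real" where
  "affine_max ms b = Sup (affine ms b ` cube (length ms))"

definition first_nonzero :: "int list \<Rightarrow> nat option" where
  "first_nonzero ms = find (\<lambda>k. ms ! k \<noteq> 0) [0..<length ms]"

lemma first_nonzero_SomeD:
  "first_nonzero ms = Some k \<Longrightarrow> k < length ms \<and> ms ! k \<noteq> 0 \<and> (\<forall>i<k. ms ! i = 0)"
  by (auto simp: first_nonzero_def find_Some_iff)

lemma sum_list_abs_update:
  "k < length ms \<Longrightarrow>
    (\<Sum>m\<leftarrow>ms[k := c]. nat \<bar>m\<bar>) + nat \<bar>ms ! k\<bar> = (\<Sum>m\<leftarrow>ms. nat \<bar>m\<bar>) + nat \<bar>c\<bar>" for c :: int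
  by (induction ms arbitrary: k) (auto split: nat.splits simp: less_Suc_eq_0_disj)

lemma first_nonzero_uminus: "first_nonzero (map uminus ms) = first_nonzero ms"
  unfolding first_nonzero_def length_map by (rule find_cong) auto

text \<open>\<open>extr ms b\<close> is the formula extracted from the clipped affine function with integer
  coefficients \<open>ms\<close> and constant term \<open>b\<close>. The case \<open>None\<close> is unreachable: the function is then
  a constant integer, which is either \<open>\<ge> 1\<close> or \<open>\<le> 0\<close>.\<close>

function extr :: "int list \<Rightarrow> int \<Rightarrow> formula" where
  "extr ms b =
    (if affine_min ms b \<ge> 1 then One
     else if affine_max ms b \<le> 0 then Zero
     else case first_nonzero ms of
        None \<Rightarrow> Zero
      | Some k \<Rightarrow>
          if ms ! k \<ge> 1 then
            odot_simp (oplus_simp (extr (ms[k := ms ! k - 1]) b) (Var k))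
                      (extr (ms[k := ms ! k - 1]) (b + 1))
          else Neg (extr (map uminus ms) (1 - b)))"
  by pat_completeness auto
termination
proof (relation "measure (\<lambda>(ms, b). 2 * (\<Sum>m\<leftarrow>ms. nat \<bar>m\<bar>) +
    (case first_nonzero ms of None \<Rightarrow> 0 | Some k \<Rightarrow> if ms ! k < 0 then 1 else 0))",
    goal_cases)
  case 1
  show ?case by simp
next
  case (2 ms b k)
  then show ?case
    using sum_list_abs_update[of k ms "ms ! k - 1"] first_nonzero_SomeD[of ms k]
    by (auto split: option.splits)
next
  case (3 ms b k)
  then show ?case
    using sum_list_abs_update[of k ms "ms ! k - 1"] first_nonzero_SomeD[of ms k]
    by (auto split: option.splits)
next
  case (4 ms b k)
  then show ?case
    using first_nonzero_SomeD[of ms k]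
    by (auto simp: first_nonzero_uminus o_def)
qed

declare extr.simps [simp del]

text \<open>The denominator of a rational number in lowest terms; meant for arguments in \<open>\<rat>\<close>.\<close>

definition denominator :: "real \<Rightarrow> nat" where
  "denominator r = nat (snd (quotient_of (THE q. of_rat q = r)))"

definition common_denominator :: "node \<Rightarrow> nat" where
  "common_denominator v = Lcm (denominator ` insert (bias v) (set (weights v)))"

text \<open>The products with \<open>s\<close> below are integers, so \<open>floor\<close> is only a change of type.\<close>

definition node_formula :: "node \<Rightarrow> formula" where
  "node_formula v =
    (let s = common_denominator v
     in big_oplus (map (\<lambda>i. DeltaSuc (s - 1)
          (extr (map (\<lambda>w. \<lfloor>real s * w\<rfloor>) (weights v)) (\<lfloor>real s * bias v\<rfloor> - int i))) [0..<s]))"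

subsection \<open>Substitution graphs\<close>

text \<open>A substitution graph is given by the formulae of its nodes, level by level starting with
  level 0. \<open>subst_level fs\<close> replaces each variable by the formula of the node of that index.\<close>

type_synonym subst_graph = "formula list list"

definition subst_level :: "formula list \<Rightarrow> formula \<Rightarrow> formula" where
  "subst_level fs = subst (\<lambda>i. if i < length fs then fs ! i else Var i)"

text \<open>\<open>foldr\<close> applies the level preceding the output first and level 0 last.\<close>

definition represented_formula :: "subst_graph \<Rightarrow> formula" where
  "represented_formula G = foldr subst_level (butlast G) (hd (last G))"

definition ext :: "network \<Rightarrow> subst_graph" where
  "ext N = map Var [0..<input_dim N] # map (map node_formula) (layers (clip_network N))"

definition network_derivable :: "(formula \<times> formula) set \<Rightarrow> network \<Rightarrow> network \<Rightarrow> bool" where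
  "network_derivable Ax N1 N2 \<longleftrightarrow>
    derivable Ax (represented_formula (ext N1)) (represented_formula (ext N2))"

end

theory Submission
  imports Defs "HOL-Library.Multiset"
begin

text \<open>The extracted formula has the truth function \<open>realization N\<close> on the cube, so everything
  rests on the completeness of \<open>DMV\<close> for truth functions on \<open>[0,1]\<close>, a divisible version of
  Chang's completeness theorem. In the Lindenbaum algebra, a nonzero element is avoided by a prime
  ideal. Modulo that ideal, an inequality between finite sums of elements is made sense of without
  truncation by first scaling all summands with \<open>\<delta>\<close> of a large index; this replaces the
  ordered group of the usual proof. Farkas' lemma, applied to the finitely many linear conditions
  that a valuation must satisfy on the subformulas of two given formulas, then yields a rational
  valuation that separates them.\<close>

text \<open>Cancellation is the obstacle: \<open>x + z \<le> y + z\<close> says nothing about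
  \<open>x\<close> and \<open>y\<close> once the truncated sums reach the top, so linear reasoning
  is unsound in the algebra itself. After division by \<open>k + 1\<close>, up to
  \<open>k + 1\<close> elements can be added without truncation, and such sums cancel. No single
  \<open>k\<close> serves for all multisets, so comparisons are required for all large
  \<open>k\<close> only. The quotient by a prime ideal may contain infinitesimals and need not embed
  in the reals. This does no harm, because only finitely many elements matter: if no valuation
  separates, Farkas' lemma yields a finite combination of valid inequalities, and a finite
  combination can be replayed with scaled sums.\<close>

section \<open>Divisible MV-algebras\<close>

text \<open>Addition is the truncated sum \<open>\<oplus>\<close>, unary minus is negation (so \<open>- 0\<close> is the top element),
  and binary minus is truncated subtraction \<open>x \<odot> \<not> y\<close>.\<close>

class mv_algebra = comm_monoid_add + uminus + minus + ord +
  assumes uminus_uminus [simp]: "- (- x) = x"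
    and add_top: "x + - 0 = - 0"
    and lukasiewicz: "- (- x + y) + y = - (- y + x) + x"
    and diff_def: "x - y = - (- x + y)"
    and less_eq_def: "x \<le> y \<longleftrightarrow> - x + y = - 0"
    and less_def: "x < y \<longleftrightarrow> x \<le> y \<and> x \<noteq> y"
begin

lemma uminus_add_self: "- x + x = - 0"
  using lukasiewicz[of x "- 0"] by (simp add: add_top)

lemma le_add_self: "x \<le> x + y"
proof -
  have "- x + (x + y) = (- x + x) + y" by (simp add: add.assoc)
  then show ?thesis
    using add_top[of y] by (simp only: less_eq_def uminus_add_self add.commute[of "- 0" y])
qed

text \<open>Both sides of the Lukasiewicz axiom denote the join of \<open>x\<close> and
  \<open>y\<close>; for comparable elements one of them reduces to the larger element.\<close>

lemma le_imp_add: "x \<le> y \<Longrightarrow> (y - x) + x = y"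
  using lukasiewicz[of x y] by (simp add: less_eq_def diff_def)

subclass order
proof
  fix x y z :: 'a
  show "x < y \<longleftrightarrow> x \<le> y \<and> \<not> y \<le> x"
    using le_imp_add[of x y] le_imp_add[of y x] lukasiewicz[of x y]
    by (auto simp: less_def diff_def less_eq_def uminus_add_self)
  show "x \<le> x" by (simp add: less_eq_def uminus_add_self)
  show "x \<le> z" if "x \<le> y" "y \<le> z"
    using le_imp_add[OF that(1)] le_imp_add[OF that(2)] le_add_self[of x "(z - y) + (y - x)"]
    by (metis add.assoc add.commute)
  show "x = y" if "x \<le> y" "y \<le> x"
    using that lukasiewicz[of x y] by (simp add: less_eq_def)
qed

subclass ordered_comm_monoid_add
proof
  show "c + a \<le> c + b" if "a \<le> b" for a b c :: 'a
    using le_imp_add[OF that] le_add_self[of "c + a" "b - a"] by (metis add.assoc add.commute)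
qed

lemma zero_le: "0 \<le> x"
  using le_add_self[of 0 x] by simp

lemma le_top: "x \<le> - 0"
  by (simp add: less_eq_def add_top)

lemma le_zero_iff: "x \<le> 0 \<longleftrightarrow> x = 0"
  using order.antisym[OF _ zero_le[of x]] by auto

lemma uminus_le_iff: "- x \<le> - y \<longleftrightarrow> y \<le> x"
  by (simp add: less_eq_def add.commute)

lemma le_uminus_iff: "x \<le> - y \<longleftrightarrow> y \<le> - x"
  by (simp add: less_eq_def add.commute)

text \<open>Both inequalities unfold to \<open>- x + (y + z) = - 0\<close>. This adjunction between
  truncated subtraction and addition carries most of the later estimates.\<close>

lemma diff_le_iff: "x - y \<le> z \<longleftrightarrow> x \<le> y + z"
  by (simp add: less_eq_def diff_def add.assoc)

lemma diff_eq_zero_iff: "x - y = 0 \<longleftrightarrow> x \<le> y"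
  using diff_le_iff[of x y 0] by (simp add: le_zero_iff)

lemma le_add_diff: "x \<le> y + (x - y)"
  using diff_le_iff by blast

lemma diff_mono: "x \<le> x' \<Longrightarrow> x - y \<le> x' - y"
  using diff_le_iff le_add_diff order_trans by blast

lemma diff_le_self: "x - y \<le> x"
  by (simp add: diff_le_iff add.commute le_add_self)

lemma diff_le_uminus: "x - y \<le> - y"
  by (simp add: diff_def uminus_le_iff add.commute le_add_self)

lemma uminus_diff: "- x - y = - (x + y)"
  by (simp add: diff_def)

lemma add_le_if_le_diff: "x \<le> z - y \<Longrightarrow> y \<le> z \<Longrightarrow> x + y \<le> z"
  using add_right_mono[of x "z - y" y] le_imp_add[of y z] by simp

lemma sup_le: "x \<le> z \<Longrightarrow> y \<le> z \<Longrightarrow> (x - y) + y \<le> z"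
  by (simp add: add_le_if_le_diff diff_mono)

lemma add_diff_add_le: "(x + x') - (y + y') \<le> (x - y) + (x' - y')"
proof -
  have "x + x' \<le> (y + (x - y)) + (y' + (x' - y'))" by (intro add_mono le_add_diff)
  then show ?thesis by (simp add: diff_le_iff ac_simps)
qed

text \<open>\<open>perp x y\<close> says that \<open>x + y\<close> is not truncated; these sums form a cancellative partial
  monoid (an effect algebra).\<close>

definition perp :: "'a \<Rightarrow> 'a \<Rightarrow> bool" where
  "perp x y \<longleftrightarrow> x \<le> - y"

lemma perp_commute: "perp x y \<longleftrightarrow> perp y x"
  by (simp add: perp_def le_uminus_iff)

lemma perp_mono: "perp x y \<Longrightarrow> x' \<le> x \<Longrightarrow> y' \<le> y \<Longrightarrow> perp x' y'"
  unfolding perp_def using uminus_le_iff[of y y'] by (metis order_trans)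

lemma perp_zero: "perp 0 x"
  by (simp add: perp_def zero_le)

text \<open>Negation turns this into \<open>le_imp_add\<close>: since \<open>y \<le> - x\<close>,
  the element \<open>- x\<close> equals \<open>(- x - y) + y\<close>.\<close>

lemma perp_add_diff: "perp x y \<Longrightarrow> (x + y) - y = x"
  using le_imp_add[of y "- x"] unfolding perp_def
  by (metis diff_def le_uminus_iff uminus_diff uminus_uminus)

lemma perp_assoc: "perp x y \<Longrightarrow> perp (x + y) z \<Longrightarrow> perp x (y + z)"
  using diff_mono[of "x + y" "- z" y] perp_add_diff[of x y]
  by (simp add: perp_def uminus_diff add.commute)

lemma perp_assoc': "perp y z \<Longrightarrow> perp x (y + z) \<Longrightarrow> perp (x + y) z"
  by (metis add.commute perp_assoc perp_commute)

lemma perp_left: "perp (x + y) z \<Longrightarrow> perp x z"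
  using perp_mono le_add_self by blast

lemma perp_diff: "perp (x - y) y"
  by (simp add: perp_def diff_le_uminus)

lemma perp_le_cancel: "perp x z \<Longrightarrow> x + z \<le> y + z \<Longrightarrow> x \<le> y"
  using perp_add_diff[of x z] by (metis add.commute diff_le_iff)

section \<open>Disjoint elements and multiples\<close>

definition orth :: "'a \<Rightarrow> 'a \<Rightarrow> bool" where
  "orth x y \<longleftrightarrow> (\<forall>z. z \<le> x \<longrightarrow> z \<le> y \<longrightarrow> z = 0)"

lemma orth_commute: "orth x y \<longleftrightarrow> orth y x"
  by (auto simp: orth_def)

lemma orth_add:
  assumes "orth x y" "orth x z"
  shows "orth x (y + z)"
  unfolding orth_def
proof (intro allI impI)
  fix w assume w: "w \<le> x" "w \<le> y + z"
  then have "w - y \<le> x" "w - y \<le> z"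
    using diff_le_self order_trans by (blast, simp add: diff_le_iff)
  then have "w \<le> y"
    using assms(2) by (simp add: orth_def diff_eq_zero_iff[symmetric])
  then show "w = 0" using w(1) assms(1) by (simp add: orth_def)
qed

text \<open>Prelinearity. A common lower bound \<open>z\<close> of the two differences can be
  subtracted from the join \<open>s\<close> without dropping below \<open>x\<close> or
  \<open>y\<close>; hence \<open>s \<le> s - z\<close>, and cancellation forces
  \<open>z = 0\<close>.\<close>

lemma orth_diff_diff: "orth (x - y) (y - x)"
  unfolding orth_def
proof (intro allI impI)
  fix z assume z: "z \<le> x - y" "z \<le> y - x"
  define s where "s = (x - y) + y"
  have s': "s = (y - x) + x"
    using lukasiewicz[of x y] by (simp add: s_def diff_def)
  \<comment> \<open>\<open>s\<close> is the untruncated sum of \<open>y\<close>,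
    \<open>(x - y) - z\<close> and \<open>z\<close>, so removing \<open>z\<close> leaves at least
    \<open>y\<close>.\<close>
  have *: "y \<le> s - z" if "z \<le> x - y" "s = (x - y) + y" for x y
  proof -
    have "perp y (x - y)" using perp_diff perp_commute by blast
    then have "perp y (z + ((x - y) - z))"
      using le_imp_add[OF that(1)] by (simp add: add.commute)
    then have "perp (y + ((x - y) - z)) z"
      by (metis add.commute perp_assoc' perp_diff)
    then have "(y + ((x - y) - z)) + z - z = y + ((x - y) - z)"
      by (rule perp_add_diff)
    moreover have "(y + ((x - y) - z)) + z = s"
      using le_imp_add[OF that(1)] that(2) by (metis add.assoc add.commute)
    ultimately show ?thesis by (metis le_add_self)
  qed
  have "y \<le> s - z" "x \<le> s - z"
    using *[OF z(1)] *[OF z(2)] s_def s' by auto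
  then have "s \<le> s - z" unfolding s_def by (intro sup_le) auto
  moreover have "z \<le> s"
    using z(1) le_add_self order_trans s_def by blast
  ultimately have "z + (s - z) \<le> 0 + (s - z)"
    using le_imp_add by (simp add: add.commute)
  then show "z = 0"
    using perp_le_cancel[of z "s - z" 0] perp_diff perp_commute le_zero_iff by blast
qed

primrec nmul :: "nat \<Rightarrow> 'a \<Rightarrow> 'a" where
  "nmul 0 x = 0"
| "nmul (Suc n) x = x + nmul n x"

lemma nmul_add_left: "nmul (m + n) x = nmul m x + nmul n x"
  by (induction m) (auto simp: add.assoc)

lemma nmul_add_right: "nmul n (x + y) = nmul n x + nmul n y"
  by (induction n) (auto simp: ac_simps)

lemma nmul_mono: "x \<le> y \<Longrightarrow> nmul n x \<le> nmul n y"
  by (induction n) (auto intro: add_mono)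

lemma nmul_mono_left: "m \<le> n \<Longrightarrow> nmul m x \<le> nmul n x"
  using nmul_add_left[of m "n - m" x] le_add_self[of "nmul m x"] by auto

lemma le_nmul: "n > 0 \<Longrightarrow> x \<le> nmul n x"
  by (cases n) (auto simp: le_add_self)

lemma orth_nmul: "orth x y \<Longrightarrow> orth x (nmul n y)"
  by (induction n) (auto simp: orth_add, auto simp: orth_def le_zero_iff)

lemma orth_nmul_nmul: "orth x y \<Longrightarrow> orth (nmul m x) (nmul n y)"
  using orth_nmul orth_commute by blast

text \<open>\<open>perp x (nmul k x)\<close> says that \<open>k + 1\<close> copies of
  \<open>x\<close> add up without truncation; any two groups of at most \<open>k + 1\<close> copies
  in total inherit this.\<close>

lemma perp_nmul_nmul: "perp x (nmul k x) \<Longrightarrow> i + j \<le> Suc k \<Longrightarrow> perp (nmul i x) (nmul j x)"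
proof (induction i)
  case 0
  then show ?case by (simp add: perp_zero)
next
  case (Suc i)
  have "perp x (nmul i x + nmul j x)"
    using Suc.prems nmul_mono_left[of "i + j" k x] perp_mono[of x "nmul k x"] nmul_add_left[of i j x]
    by auto
  then show ?case using Suc perp_assoc' by auto
qed

lemma nmul_perp_split:
  assumes "perp c d" "perp (c + d) (nmul k (c + d))" "j \<le> Suc k"
  shows "perp (nmul j d) (nmul j c)"
  using assms(3)
proof (induction j)
  case 0
  then show ?case by (simp add: perp_zero)
next
  case (Suc j)
  have kj: "perp (nmul j d) (nmul j c)" using Suc by simp
  have "perp (c + d) (nmul j c + nmul j d)"
    using perp_mono[OF assms(2) order_refl nmul_mono_left[of j k]] Suc.prems
    by (simp add: nmul_add_right)
  then have c: "perp c (d + (nmul j c + nmul j d))" and d: "perp d (nmul j d + nmul j c)"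
    using assms(1) perp_assoc perp_left[of d c] by (auto simp: add.commute)
  from d kj have "perp (d + nmul j d) (nmul j c)" by (metis perp_assoc')
  moreover from c have "perp (d + nmul j d + nmul j c) c"
    by (simp add: perp_commute ac_simps)
  ultimately show ?case
    using perp_assoc[of "d + nmul j d" "nmul j c" c] by (simp add: add.commute)
qed

text \<open>Both sides are the meet of \<open>x\<close> and \<open>y\<close>: this is the
  Lukasiewicz axiom for the negated elements.\<close>

lemma diff_diff_commute: "x - (x - y) = y - (y - x)"
  using lukasiewicz[of "- x" "- y"] by (simp add: diff_def add.commute)

lemma diff_diff_add: "(x - (x - y)) + (x - y) = x"
  by (simp add: le_imp_add diff_le_self)

text \<open>With \<open>c\<close> the meet, \<open>x = c + (x - y)\<close> and
  \<open>y = c + (y - x)\<close>. The claim is what remains of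
  \<open>nmul j x \<le> nmul j y + (nmul j x - nmul j y)\<close> after cancelling
  \<open>nmul j c\<close>.\<close>

lemma nmul_diff_le:
  assumes "perp x (nmul k x)" "j \<le> Suc k"
  shows "nmul j (x - y) \<le> nmul j (y - x) + (nmul j x - nmul j y)"
proof -
  define c where "c = x - (x - y)"
  have x: "c + (x - y) = x" and y: "c + (y - x) = y"
    using diff_diff_add[of x y] diff_diff_add[of y x] by (simp_all add: c_def diff_diff_commute)
  have "perp c (x - y)" by (simp add: c_def perp_diff)
  then have "perp (nmul j (x - y)) (nmul j c)"
    using nmul_perp_split[of c "x - y" k j] assms x by simp
  moreover have "nmul j (x - y) + nmul j c
      \<le> (nmul j (y - x) + (nmul j x - nmul j y)) + nmul j c"
    using le_add_diff[of "nmul j x" "nmul j y"] x y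
    by (metis (no_types, lifting) add.assoc add.commute nmul_add_right)
  ultimately show ?thesis by (rule perp_le_cancel)
qed

text \<open>The last term of \<open>nmul_diff_le\<close> vanishes here, so a multiple of
  \<open>x - y\<close> lies below a multiple of the orthogonal element \<open>y - x\<close> and must
  be 0.\<close>

lemma nmul_le_cancel:
  assumes "perp x (nmul k x)" "nmul (Suc k) x \<le> nmul (Suc k) y"
  shows "x \<le> y"
proof -
  have "nmul (Suc k) (x - y) \<le> nmul (Suc k) (y - x)"
    using nmul_diff_le[OF assms(1), of "Suc k" y] diff_eq_zero_iff[THEN iffD2, OF assms(2)]
    by (simp del: nmul.simps)
  then have "nmul (Suc k) (x - y) = 0"
    using orth_nmul_nmul[OF orth_diff_diff] unfolding orth_def by blast
  then have "x - y \<le> 0" using le_nmul[of "Suc k" "x - y"] by simp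
  then show ?thesis by (simp add: le_zero_iff diff_eq_zero_iff)
qed

section \<open>Ideals and the existence of prime ideals\<close>

definition ideal :: "'a set \<Rightarrow> bool" where
  "ideal I \<longleftrightarrow> 0 \<in> I \<and> (\<forall>x\<in>I. \<forall>y\<in>I. x + y \<in> I) \<and> (\<forall>x\<in>I. \<forall>y. y \<le> x \<longrightarrow> y \<in> I)"

text \<open>Primeness makes the quotient totally ordered. The quotient is never formed; relations in
  it are expressed by membership in \<open>I\<close>.\<close>

definition prime_ideal :: "'a set \<Rightarrow> bool" where
  "prime_ideal I \<longleftrightarrow> ideal I \<and> (\<forall>x y. x - y \<in> I \<or> y - x \<in> I)"

lemma ideal_zero: "ideal I \<Longrightarrow> 0 \<in> I"
  and ideal_add: "ideal I \<Longrightarrow> x \<in> I \<Longrightarrow> y \<in> I \<Longrightarrow> x + y \<in> I"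
  and ideal_down: "ideal I \<Longrightarrow> x \<in> I \<Longrightarrow> y \<le> x \<Longrightarrow> y \<in> I"
  by (auto simp: ideal_def)

lemma ideal_nmul: "ideal I \<Longrightarrow> x \<in> I \<Longrightarrow> nmul n x \<in> I"
  by (induction n) (auto simp: ideal_zero ideal_add)

lemma ideal_adjoin:
  assumes "ideal I"
  shows "ideal {z. \<exists>x\<in>I. \<exists>n. z \<le> x + nmul n a}"
  unfolding ideal_def
proof (intro conjI ballI allI impI)
  show "0 \<in> {z. \<exists>x\<in>I. \<exists>n. z \<le> x + nmul n a}"
    using ideal_zero[OF assms] zero_le by blast
next
  fix z z' assume "z \<in> {z. \<exists>x\<in>I. \<exists>n. z \<le> x + nmul n a}" "z' \<in> {z. \<exists>x\<in>I. \<exists>n. z \<le> x + nmul n a}"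
  then obtain x n x' n' where "x \<in> I" "x' \<in> I" "z \<le> x + nmul n a" "z' \<le> x' + nmul n' a"
    by blast
  then have "x + x' \<in> I" "z + z' \<le> (x + x') + nmul (n + n') a"
    using ideal_add[OF assms] add_mono[of z "x + nmul n a" z' "x' + nmul n' a"]
    by (auto simp: nmul_add_left ac_simps)
  then show "z + z' \<in> {z. \<exists>x\<in>I. \<exists>n. z \<le> x + nmul n a}" by blast
next
  fix z z' assume "z \<in> {z. \<exists>x\<in>I. \<exists>n. z \<le> x + nmul n a}" "z' \<le> z"
  then show "z' \<in> {z. \<exists>x\<in>I. \<exists>n. z \<le> x + nmul n a}"
    using order_trans by blast
qed

text \<open>An ideal maximal among those avoiding \<open>d\<close> is prime: if both differences lay
  outside, adjoining either one would capture \<open>d\<close>, and up to an element of the ideal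
  \<open>d\<close> would lie below multiples of two orthogonal elements.\<close>

lemma exists_prime_ideal:
  assumes "d \<noteq> 0"
  shows "\<exists>I. prime_ideal I \<and> d \<notin> I"
proof -
  let ?A = "{I. ideal I \<and> d \<notin> I}"
  have "\<exists>M\<in>?A. \<forall>X\<in>?A. M \<subseteq> X \<longrightarrow> X = M"
  proof (rule subset_Zorn_nonempty)
    have "{0} \<in> ?A" using assms by (simp add: ideal_def le_zero_iff)
    then show "?A \<noteq> {}" by blast
  next
    fix C assume C: "C \<noteq> {}" "subset.chain ?A C"
    then have A: "I \<in> C \<Longrightarrow> ideal I \<and> d \<notin> I" for I
      by (auto simp: subset.chain_def)
    have "x + y \<in> \<Union>C" if xy: "x \<in> \<Union>C" "y \<in> \<Union>C" for x y
    proof -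
      obtain I J where IJ: "I \<in> C" "J \<in> C" "x \<in> I" "y \<in> J" using xy by blast
      then consider "I \<subseteq> J" | "J \<subseteq> I" using C(2) unfolding subset.chain_def by blast
      then show ?thesis using IJ A ideal_add by cases blast+
    qed
    then have "ideal (\<Union>C)"
      using C(1) A unfolding ideal_def by blast
    then show "\<Union>C \<in> ?A" using A by blast
  qed
  then obtain M where M: "ideal M" "d \<notin> M" and max: "\<And>X. ideal X \<Longrightarrow> d \<notin> X \<Longrightarrow> M \<subseteq> X \<Longrightarrow> X = M"
    by blast
  have *: "\<exists>x\<in>M. \<exists>n. d \<le> x + nmul n a" if "a \<notin> M" for a
  proof (rule ccontr)
    let ?X = "{z. \<exists>x\<in>M. \<exists>n. z \<le> x + nmul n a}"
    assume "\<not> ?thesis"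
    then have "d \<notin> ?X" by blast
    moreover have "x \<in> ?X" if "x \<in> M" for x using that le_add_self by blast
    ultimately have "?X = M" using max[OF ideal_adjoin[OF M(1)]] by blast
    moreover have "a \<le> 0 + nmul 1 a" by simp
    then have "a \<in> ?X" using ideal_zero[OF M(1)] by blast
    ultimately show False using that by blast
  qed
  have "x - y \<in> M \<or> y - x \<in> M" for x y
  proof (rule ccontr)
    assume "\<not> ?thesis"
    then obtain u m v n where uv: "u \<in> M" "v \<in> M"
      and d: "d \<le> u + nmul m (x - y)" "d \<le> v + nmul n (y - x)"
      using *[of "x - y"] *[of "y - x"] by blast
    have "d - (u + v) \<le> nmul m (x - y)" "d - (u + v) \<le> nmul n (y - x)"
      using d add_right_mono[OF d(1), of v] add_right_mono[OF d(2), of u]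
        le_add_self[of d v] le_add_self[of d u]
      by (auto simp: diff_le_iff ac_simps intro: order_trans)
    then have "d \<le> u + v"
      using orth_nmul_nmul[OF orth_diff_diff, of m x y n] unfolding orth_def
      by (simp add: diff_eq_zero_iff[symmetric])
    then show False using ideal_down[OF M(1) ideal_add[OF M(1) uv]] M(2) by blast
  qed
  then show ?thesis using M unfolding prime_ideal_def by blast
qed

end

text \<open>\<open>dv k\<close> divides by \<open>k + 1\<close>.\<close>

class divisible_mv_algebra = mv_algebra +
  fixes dv :: "nat \<Rightarrow> 'a \<Rightarrow> 'a"
  assumes nmul_dv: "nmul (Suc k) (dv k x) = x"
    and dv_perp: "perp (dv k x) (nmul k (dv k x))"
begin

text \<open>Division is the lower adjoint of the \<open>k + 1\<close>-fold sum. Cancelling the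
  factor is possible because the copies of \<open>dv k x\<close> add up without truncation.\<close>

lemma dv_le_iff: "dv k x \<le> y \<longleftrightarrow> x \<le> nmul (Suc k) y"
  using nmul_le_cancel[OF dv_perp, of k x y] nmul_mono[of "dv k x" y "Suc k"]
  by (auto simp: nmul_dv simp del: nmul.simps)

lemma dv_le_self: "dv k x \<le> x"
  by (simp add: dv_le_iff le_add_self)

lemma dv_mono: "x \<le> y \<Longrightarrow> dv k x \<le> dv k y"
  by (simp add: dv_le_iff nmul_dv del: nmul.simps)

lemma dv_zero: "dv k 0 = 0"
  using dv_le_self[of k 0] by (simp add: le_zero_iff)

lemma dv_add_le: "dv k (x + y) \<le> dv k x + dv k y"
  by (simp add: dv_le_iff nmul_dv nmul_add_right del: nmul.simps)

text \<open>One half is subadditivity. For the other, \<open>k + 1\<close> copies each of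
  \<open>dv k x\<close> and \<open>dv k y\<close> add up to \<open>x + y\<close> without truncation,
  hence regroup into copies of \<open>dv k x + dv k y\<close>, and the factor cancels.\<close>

lemma dv_add:
  assumes "perp x y"
  shows "dv k (x + y) = dv k x + dv k y"
proof (rule order.antisym[OF dv_add_le])
  let ?p = "dv k x" and ?q = "dv k y"
  have "perp (?p + nmul k ?p) (?q + nmul k ?q)"
    using assms nmul_dv[of k x] nmul_dv[of k y] by simp
  then have p: "perp ?p (nmul k ?p + (?q + nmul k ?q))" and q: "perp (nmul k ?p) (?q + nmul k ?q)"
    using perp_assoc[OF dv_perp[of k x]] perp_left[of "nmul k ?p" ?p]
    by (blast, simp add: add.commute)
  have "perp ?q (nmul k ?q + nmul k ?p)"
    using perp_assoc[OF dv_perp[of k y]] q perp_commute by blast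
  moreover have "perp ?p (?q + (nmul k ?q + nmul k ?p))"
    using p by (simp add: ac_simps)
  ultimately have "perp (?p + ?q) (nmul k ?q + nmul k ?p)" by (rule perp_assoc')
  then have "perp (?p + ?q) (nmul k (?p + ?q))"
    by (simp add: nmul_add_right add.commute)
  moreover have "nmul (Suc k) (?p + ?q) = nmul (Suc k) (dv k (x + y))"
    by (simp only: nmul_add_right nmul_dv)
  ultimately show "?p + ?q \<le> dv k (x + y)"
    using nmul_le_cancel by simp
qed

lemma dv_nmul: "perp x (nmul n x) \<Longrightarrow> i \<le> Suc n \<Longrightarrow> dv k (nmul i x) = nmul i (dv k x)"
proof (induction i)
  case 0
  then show ?case by (simp add: dv_zero)
next
  case (Suc i)
  then have "perp x (nmul i x)" using perp_nmul_nmul[of x n 1 i] by simp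
  then show ?case using Suc by (simp add: dv_add)
qed

section \<open>Scaled sums of multisets\<close>

definition dvsum :: "nat \<Rightarrow> 'a multiset \<Rightarrow> 'a" where
  "dvsum k xs = (\<Sum>x\<in>#xs. dv k x)"

lemma dvsum_union: "dvsum k (xs + ys) = dvsum k xs + dvsum k ys"
  by (simp add: dvsum_def)

lemma dvsum_replicate: "dvsum k (replicate_mset n x) = nmul n (dv k x)"
  by (induction n) (auto simp: dvsum_def)

lemma dvsum_le: "dvsum k xs \<le> nmul (size xs) (dv k (- 0))"
  by (induction xs) (auto simp: dvsum_def intro!: add_mono dv_mono le_top)

text \<open>Each summand is at most \<open>dv k (- 0)\<close>, and \<open>k + 1\<close> copies of
  that element add up without truncation.\<close>

lemma dvsum_perp: "size xs + size ys \<le> Suc k \<Longrightarrow> perp (dvsum k xs) (dvsum k ys)"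
  using perp_nmul_nmul[OF dv_perp, of "size xs" "size ys" k "- 0"] perp_mono dvsum_le by blast

lemma dvsum_uminus: "dvsum k {#x, - x#} = dvsum k {#- 0#}"
proof -
  have "x + - x = - 0" using uminus_add_self[of x] by (simp only: add.commute[of x])
  then show ?thesis using dv_add[of x "- x" k] by (simp add: dvsum_def perp_def)
qed

lemma dvsum_dv: "dvsum k (replicate_mset (Suc j) (dv j x)) = dvsum k {#x#}"
  unfolding dvsum_replicate
  using dv_nmul[OF dv_perp le_refl, of k j x] by (simp add: dvsum_def nmul_dv del: nmul.simps)

text \<open>Inequality of untruncated sums modulo \<open>I\<close>: once \<open>k\<close> exceeds the sizes of the multisets,
  the scaled sums \<open>dvsum k\<close> are not truncated.\<close>

definition mset_le :: "'a set \<Rightarrow> 'a multiset \<Rightarrow> 'a multiset \<Rightarrow> bool" where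
  "mset_le I xs ys \<longleftrightarrow> (\<forall>\<^sub>F k in sequentially. dvsum k xs - dvsum k ys \<in> I)"

lemma mset_leI: "(\<And>k. dvsum k xs - dvsum k ys \<in> I) \<Longrightarrow> mset_le I xs ys"
  by (simp add: mset_le_def)

lemma mset_le_if_le: "ideal I \<Longrightarrow> (\<And>k. dvsum k xs \<le> dvsum k ys) \<Longrightarrow> mset_le I xs ys"
  by (rule mset_leI) (simp add: diff_eq_zero_iff[THEN iffD2] ideal_zero)

lemma mset_le_add:
  assumes I: "ideal I" and "mset_le I xs ys" "mset_le I xs' ys'"
  shows "mset_le I (xs + xs') (ys + ys')"
  using assms(2,3) unfolding mset_le_def
proof eventually_elim
  case (elim k)
  then show ?case
    using ideal_down[OF I ideal_add[OF I elim] add_diff_add_le] by (simp add: dvsum_union)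
qed

text \<open>The defect \<open>?r\<close> of the hypothesis lies in \<open>I\<close>. For
  \<open>k\<close> at least the size of the left multiset the left sum is untruncated, so
  \<open>zs\<close> cancels and only the defect remains.\<close>

lemma mset_le_cancel:
  assumes I: "ideal I" and "mset_le I (xs + zs) (ys + zs)"
  shows "mset_le I xs ys"
  using assms(2) eventually_ge_at_top[of "size xs + size zs"] unfolding mset_le_def
proof eventually_elim
  case (elim k)
  let ?r = "dvsum k (xs + zs) - dvsum k (ys + zs)"
  have "dvsum k xs + dvsum k zs \<le> (dvsum k ys + ?r) + dvsum k zs"
    using le_add_diff[of "dvsum k (xs + zs)" "dvsum k (ys + zs)"] by (simp add: dvsum_union ac_simps)
  then have "dvsum k xs \<le> dvsum k ys + ?r"
    using dvsum_perp[of xs zs k] elim(2) perp_le_cancel by simp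
  then show ?case using ideal_down[OF I elim(1)] by (simp add: diff_le_iff)
qed

text \<open>For the two scaled differences \<open>d\<close> and \<open>e\<close>, a multiple of
  \<open>d\<close> is bounded by a multiple of \<open>e\<close> up to an element of
  \<open>I\<close>. Primeness puts \<open>d\<close> or \<open>e\<close> into \<open>I\<close>;
  either way \<open>d\<close> is there, and \<open>k + 1\<close> copies of \<open>d\<close> dominate
  \<open>x - y\<close>.\<close>

lemma mset_le_replicateD:
  assumes I: "prime_ideal I" and "n > 0" and "mset_le I (replicate_mset n x) (replicate_mset n y)"
  shows "x - y \<in> I"
proof -
  have idl: "ideal I" using I by (simp add: prime_ideal_def)
  from assms(3) have "\<forall>\<^sub>F k in sequentially. n \<le> k \<and> nmul n (dv k x) - nmul n (dv k y) \<in> I"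
    using eventually_ge_at_top[of n] unfolding mset_le_def dvsum_replicate
    by eventually_elim simp
  then obtain k where k: "n \<le> k" and r: "nmul n (dv k x) - nmul n (dv k y) \<in> I"
    using eventually_happens'[OF sequentially_bot] by blast
  define d e where "d = dv k x - dv k y" and "e = dv k y - dv k x"
  have "nmul n d \<le> nmul n e + (nmul n (dv k x) - nmul n (dv k y))"
    unfolding d_def e_def by (rule nmul_diff_le[OF dv_perp]) (use k in simp)
  moreover have "d \<in> I \<or> e \<in> I" using I by (simp add: prime_ideal_def d_def e_def)
  ultimately have "d \<in> I"
    using ideal_add[OF idl ideal_nmul[OF idl, of e n] r] ideal_down[OF idl] le_nmul[OF \<open>n > 0\<close>, of d]
    by blast
  moreover have "x - y \<le> nmul (Suc k) d"
  proof -
    have "nmul (Suc k) (dv k x) \<le> nmul (Suc k) (dv k y + d)"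
      unfolding d_def by (rule nmul_mono[OF le_add_diff])
    then show ?thesis by (simp only: nmul_add_right nmul_dv diff_le_iff)
  qed
  ultimately show ?thesis using ideal_down[OF idl ideal_nmul[OF idl]] by blast
qed

lemma mset_le_sum:
  assumes I: "ideal I" and "finite A" "\<And>i. i \<in> A \<Longrightarrow> mset_le I (xs i) (ys i)"
  shows "mset_le I (\<Sum>i\<in>A. xs i) (\<Sum>i\<in>A. ys i)"
  using assms(2,3)
proof (induction A)
  case empty
  show ?case by (simp add: mset_le_if_le[OF I])
next
  case (insert a A)
  then show ?case by (simp add: mset_le_add[OF I])
qed

lemma mset_le_repeat:
  assumes I: "ideal I" and "mset_le I xs ys"
  shows "mset_le I (repeat_mset n xs) (repeat_mset n ys)"
proof (induction n)
  case 0
  show ?case by (simp add: mset_le_if_le[OF I])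
next
  case (Suc n)
  then show ?case using assms(2) by (simp add: mset_le_add[OF I])
qed

section \<open>Linear conditions that hold modulo an ideal\<close>

context
  fixes I assumes I: "ideal I"
begin

lemma mset_le_zero: "mset_le I {#0#} {#}"
  by (rule mset_le_if_le[OF I]) (simp add: dvsum_def dv_zero)

lemma mset_le_empty: "mset_le I {#} xs"
  by (rule mset_le_if_le[OF I]) (simp add: dvsum_def zero_le)

lemma mset_le_top: "mset_le I {#x#} {#- 0#}"
  by (rule mset_le_if_le[OF I]) (simp add: dvsum_def dv_mono le_top)

lemma mset_le_add_pair: "mset_le I {#x + y#} {#x, y#}"
  by (rule mset_le_if_le[OF I]) (simp add: dvsum_def dv_add_le add.commute)

text \<open>\<open>?r\<close> is the excess lost by truncation, the Lukasiewicz product of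
  \<open>x\<close> and \<open>y\<close>. Removing it from \<open>x\<close> makes the sum with
  \<open>y\<close> exact, and division then distributes.\<close>

lemma mset_le_pair_add:
  assumes "x - (- y) \<in> I"
  shows "mset_le I {#x, y#} {#x + y#}"
proof (rule mset_leI)
  fix k
  let ?r = "x - (- y)"
  have "perp (x - ?r) y"
    using diff_le_self[of "- y" "- y - x"] by (simp add: perp_def diff_diff_commute)
  then have "dv k ((x - ?r) + y) = dv k (x - ?r) + dv k y" by (rule dv_add)
  moreover have "dv k x \<le> dv k (x - ?r) + dv k ?r"
    using dv_add_le[of k "x - ?r" ?r] by (simp add: diff_diff_add)
  ultimately have "dv k x + dv k y \<le> dv k ?r + dv k ((x - ?r) + y)"
    using add_right_mono[of "dv k x" "dv k (x - ?r) + dv k ?r" "dv k y"]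
    by (simp add: ac_simps)
  also have "\<dots> \<le> ?r + dv k (x + y)"
    by (intro add_mono dv_le_self dv_mono diff_le_self order_refl)
  finally have "dvsum k {#x, y#} - dvsum k {#x + y#} \<le> ?r"
    by (simp add: dvsum_def diff_le_iff add.commute)
  then show "dvsum k {#x, y#} - dvsum k {#x + y#} \<in> I"
    by (rule ideal_down[OF I assms])
qed

lemma mset_le_top_add:
  assumes "(- y) - x \<in> I"
  shows "mset_le I {#- 0#} {#x + y#}"
proof (rule mset_leI)
  fix k
  let ?r = "(- y) - x"
  have "- 0 = - y + y" by (simp add: uminus_add_self)
  also have "\<dots> \<le> (x + ?r) + y" by (rule add_right_mono[OF le_add_diff])
  finally have "- 0 \<le> (x + y) + ?r" by (simp add: ac_simps)
  then have "dv k (- 0) \<le> dv k (x + y) + dv k ?r"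
    using dv_mono dv_add_le order_trans by blast
  also have "\<dots> \<le> dv k (x + y) + ?r"
    by (rule add_left_mono[OF dv_le_self])
  finally show "dvsum k {#- 0#} - dvsum k {#x + y#} \<in> I"
    using ideal_down[OF I assms] by (simp add: dvsum_def diff_le_iff)
qed

end

end

section \<open>Farkas' lemma and valuations in the rationals\<close>

definition rat_linear :: "(('a \<Rightarrow> rat) \<Rightarrow> rat) \<Rightarrow> bool" where
  "rat_linear f \<longleftrightarrow> (\<forall>v w c. f (\<lambda>x. v x + c * w x) = f v + c * f w)"

lemma rat_linearD: "rat_linear f \<Longrightarrow> f (\<lambda>x. v x + c * w x) = f v + c * f w"
  by (simp add: rat_linear_def)

lemma rat_linear_diff_scale:
  "rat_linear f \<Longrightarrow> rat_linear g \<Longrightarrow> rat_linear (\<lambda>v. f v - c * g v)"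
  by (simp add: rat_linear_def algebra_simps)

lemma rat_linear_zero: "rat_linear f \<Longrightarrow> f (\<lambda>x. 0) = 0"
  using rat_linearD[of f "\<lambda>x. 0" 1 "\<lambda>x. 0"] by simp

text \<open>Bartl's induction on the number of constraints: if the new constraint \<open>f a\<close> is needed, some
  \<open>w\<close> with \<open>f a w < 0\<close> violates the conclusion, and projecting along \<open>w\<close> onto the kernel of
  \<open>f a\<close> removes the constraint.\<close>

lemma farkas:
  fixes f :: "'i \<Rightarrow> ('a \<Rightarrow> rat) \<Rightarrow> rat"
  assumes "finite A" "\<And>i. i \<in> A \<Longrightarrow> rat_linear (f i)" "rat_linear g"
    and "\<And>v. (\<And>i. i \<in> A \<Longrightarrow> 0 \<le> f i v) \<Longrightarrow> 0 \<le> g v"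
  shows "\<exists>u. (\<forall>i\<in>A. 0 \<le> u i) \<and> (\<forall>v. g v = (\<Sum>i\<in>A. u i * f i v))"
  using assms
proof (induction A arbitrary: f g)
  case empty
  have "g v = 0" for v
    using empty(3)[of "\<lambda>x. 0 + (-1) * v x"] empty(3)[of v]
      rat_linearD[OF empty(2), of "\<lambda>x. 0" "-1" v] rat_linear_zero[OF empty(2)]
    by simp
  then show ?case by simp
next
  case (insert a A)
  have fa: "rat_linear (f a)" and fi: "\<And>i. i \<in> A \<Longrightarrow> rat_linear (f i)" using insert.prems by auto
  show ?case
  proof (cases "\<forall>v. (\<forall>i\<in>A. 0 \<le> f i v) \<longrightarrow> 0 \<le> g v")
    case True
    then obtain u where u: "\<forall>i\<in>A. 0 \<le> u i" "\<forall>v. g v = (\<Sum>i\<in>A. u i * f i v)"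
      using insert.IH[of f g] fi \<open>rat_linear g\<close> by blast
    have "(\<Sum>i\<in>A. (u(a := 0)) i * f i v) = (\<Sum>i\<in>A. u i * f i v)" for v
      using insert.hyps by (intro sum.cong) auto
    then show ?thesis
      using u insert.hyps by (intro exI[of _ "u(a := 0)"]) auto
  next
    case False
    then obtain w where w: "\<And>i. i \<in> A \<Longrightarrow> 0 \<le> f i w" "g w < 0" by (meson not_le)
    then have aw: "f a w < 0" using insert.prems(3)[of w] by (metis insertE not_le)
    define p where "p h v = h v - (h w / f a w) * f a v" for h :: "('a \<Rightarrow> rat) \<Rightarrow> rat" and v
    have lin_p: "rat_linear h \<Longrightarrow> rat_linear (p h)" for h
      using rat_linear_diff_scale[OF _ fa, of h "h w / f a w"] by (simp add: p_def[abs_def])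
    have "\<exists>u. (\<forall>i\<in>A. 0 \<le> u i) \<and> (\<forall>v. p g v = (\<Sum>i\<in>A. u i * p (f i) v))"
    proof (rule insert.IH)
      fix v assume v: "\<And>i. i \<in> A \<Longrightarrow> 0 \<le> p (f i) v"
      let ?y = "\<lambda>x. v x + (- f a v / f a w) * w x"
      have y: "h ?y = p h v" if "rat_linear h" for h
        using rat_linearD[OF that, of v "- f a v / f a w" w] by (simp add: p_def)
      have "0 \<le> f i ?y" if "i \<in> insert a A" for i
        using that v y[OF fi] y[OF fa] aw by (auto simp: p_def)
      then show "0 \<le> p g v" using insert.prems(3) y[OF \<open>rat_linear g\<close>] by metis
    qed (auto intro: lin_p fi insert.prems)
    then obtain u where u: "\<forall>i\<in>A. 0 \<le> u i" and g: "\<And>v. p g v = (\<Sum>i\<in>A. u i * p (f i) v)"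
      by blast
    \<comment> \<open>This value makes the combination agree with \<open>g\<close> at
      \<open>w\<close>. It is nonnegative because \<open>g w < 0\<close>, \<open>f a w < 0\<close>
      and the sum is nonnegative.\<close>
    define c where "c = (g w - (\<Sum>i\<in>A. u i * f i w)) / f a w"
    have "(\<Sum>i\<in>A. u i * f i w) \<ge> 0" using u w by (intro sum_nonneg) auto
    then have "c \<ge> 0" using w aw by (auto simp: c_def intro!: divide_nonpos_neg)
    moreover have "g v = c * f a v + (\<Sum>i\<in>A. u i * f i v)" for v
    proof -
      have "g v = g w / f a w * f a v + (\<Sum>i\<in>A. u i * p (f i) v)"
        using g[of v] by (simp add: p_def)
      also have "(\<Sum>i\<in>A. u i * p (f i) v) =
          (\<Sum>i\<in>A. u i * f i v) - (\<Sum>i\<in>A. u i * f i w) / f a w * f a v"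
        by (simp add: p_def right_diff_distrib sum_subtractf sum_distrib_right sum_divide_distrib
            mult.assoc)
      finally show ?thesis by (simp add: c_def diff_divide_distrib left_diff_distrib)
    qed
    moreover have "(\<Sum>i\<in>A. (u(a := c)) i * f i v) = (\<Sum>i\<in>A. u i * f i v)" for v
      using insert.hyps by (intro sum.cong) auto
    ultimately show ?thesis
      using u insert.hyps by (intro exI[of _ "u(a := c)"]) auto
  qed
qed

lemma common_multiple_rat:
  fixes u :: "'i \<Rightarrow> rat"
  assumes "finite A" "\<And>i. i \<in> A \<Longrightarrow> 0 \<le> u i"
  shows "\<exists>D>0. \<exists>n. \<forall>i\<in>A. of_nat D * u i = of_nat (n i)"
  using assms
proof (induction A)
  case empty
  show ?case by (intro exI[of _ 1]) simp
next
  case (insert a A)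
  then obtain D n where D: "D > 0" "\<forall>i\<in>A. of_nat D * u i = of_nat (n i)" by auto
  obtain p q where "quotient_of (u a) = (p, q)" by (cases "quotient_of (u a)")
  then have "u a = of_int p / of_int q" "q > 0" by (auto simp: quotient_of_div quotient_of_denom_pos)
  moreover then have "p \<ge> 0" using insert.prems[of a] by (simp add: zero_le_divide_iff)
  ultimately have q: "of_nat (nat q) * u a = of_nat (nat p)" "nat q > 0" by auto
  have "of_nat (D * nat q) * u i = of_nat (if i = a then D * nat p else nat q * n i)"
    if "i \<in> insert a A" for i
    using that q D by (auto simp: mult.assoc)
  then show ?case
    using D q by (intro exI[of _ "D * nat q"] conjI exI[of _ "\<lambda>i. if i = a then _ else _ i"]) auto
qed

section \<open>Valuations of multisets\<close>

definition msum :: "('a \<Rightarrow> rat) \<Rightarrow> 'a multiset \<Rightarrow> rat" where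
  "msum v xs = (\<Sum>x\<in>#xs. v x)"

lemma msum_simps [simp]:
  "msum v {#} = 0" "msum v (add_mset x xs) = v x + msum v xs"
  "msum v (xs + ys) = msum v xs + msum v ys"
  by (simp_all add: msum_def)

lemma msum_repeat [simp]: "msum v (repeat_mset n xs) = of_nat n * msum v xs"
  by (induction n) (auto simp: algebra_simps)

lemma msum_replicate [simp]: "msum v (replicate_mset n x) = of_nat n * v x"
  by (induction n) (auto simp: algebra_simps)

lemma msum_sum: "msum v (\<Sum>i\<in>A. xs i) = (\<Sum>i\<in>A. msum v (xs i))"
  by (induction A rule: infinite_finite_induct) auto

text \<open>Indicator valuations read off multiplicities, so multisets with equal sums under every
  valuation are equal.\<close>

lemma msum_indicator: "msum (\<lambda>y. if y = x then 1 else 0) xs = of_nat (count xs x)"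
  by (induction xs) auto

lemma rat_linear_msum: "rat_linear (\<lambda>v. msum v xs)"
  unfolding rat_linear_def by (induction xs) (auto simp: algebra_simps)

lemma rat_linear_msum_diff: "rat_linear (\<lambda>v. msum v ys - msum v xs)"
  using rat_linear_diff_scale[OF rat_linear_msum rat_linear_msum, of ys 1 xs] by simp

text \<open>Otherwise Farkas' lemma writes \<open>v b - v a\<close> as a nonnegative combination of
  the constraints. Clearing denominators gives an identity of multisets: \<open>Y\<close> with
  \<open>D\<close> copies of \<open>a\<close> is \<open>X\<close> with \<open>D\<close> copies of
  \<open>b\<close>, where \<open>X\<close> is below \<open>Y\<close> modulo \<open>I\<close>.
  Cancelling \<open>X\<close> and the factor \<open>D\<close> puts \<open>a - b\<close> into
  \<open>I\<close>.\<close>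

lemma separating_functional:
  fixes a b :: "'a :: divisible_mv_algebra"
  assumes I: "prime_ideal I" and d: "a - b \<notin> I" and C: "finite C"
    and le: "\<And>xs ys. (xs, ys) \<in> C \<Longrightarrow> mset_le I xs ys"
  obtains v where "v b < v a" "\<And>xs ys. (xs, ys) \<in> C \<Longrightarrow> msum v xs \<le> msum v ys"
proof (rule ccontr)
  assume "\<not> thesis"
  have idl: "ideal I" using I by (simp add: prime_ideal_def)
  let ?f = "\<lambda>i v. msum v (snd i) - msum v (fst i)"
  have "\<exists>u. (\<forall>i\<in>C. 0 \<le> u i) \<and> (\<forall>v. msum v {#b#} - msum v {#a#} = (\<Sum>i\<in>C. u i * ?f i v))"
  proof (rule farkas[OF C])
    fix v assume "\<And>i. i \<in> C \<Longrightarrow> 0 \<le> ?f i v"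
    then have "\<And>xs ys. (xs, ys) \<in> C \<Longrightarrow> msum v xs \<le> msum v ys" by fastforce
    then have "\<not> v b < v a" using that \<open>\<not> thesis\<close> by blast
    then show "0 \<le> msum v {#b#} - msum v {#a#}" by simp
  qed (rule rat_linear_msum_diff)+
  then obtain u where u: "\<forall>i\<in>C. 0 \<le> u i"
    and uf: "\<And>v. msum v {#b#} - msum v {#a#} = (\<Sum>i\<in>C. u i * ?f i v)"
    by blast
  from common_multiple_rat[OF C, of u] u obtain D n
    where D: "D > 0" and n: "\<And>i. i \<in> C \<Longrightarrow> of_nat D * u i = of_nat (n i)"
    by auto
  define X where "X = (\<Sum>i\<in>C. repeat_mset (n i) (fst i))"
  define Y where "Y = (\<Sum>i\<in>C. repeat_mset (n i) (snd i))"
  have eq: "msum v (Y + replicate_mset D a) = msum v (X + replicate_mset D b)" for v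
  proof -
    have "of_nat D * (v b - v a) = (\<Sum>i\<in>C. (of_nat D * u i) * ?f i v)"
      using uf[of v] by (simp add: sum_distrib_left mult.assoc)
    also have "\<dots> = (\<Sum>i\<in>C. of_nat (n i) * ?f i v)"
      by (rule sum.cong[OF refl]) (simp only: n)
    also have "\<dots> = msum v Y - msum v X"
      by (simp add: X_def Y_def msum_sum right_diff_distrib sum_subtractf)
    finally show ?thesis by (simp add: algebra_simps)
  qed
  have "of_nat (count (Y + replicate_mset D a) x) = (of_nat (count (X + replicate_mset D b) x) :: rat)"
    for x
    using eq[of "\<lambda>y. if y = x then 1 else 0"] by (simp only: msum_indicator)
  then have XY: "Y + replicate_mset D a = X + replicate_mset D b"
    by (intro multiset_eqI) (simp only: of_nat_eq_iff)
  have "mset_le I X Y"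
    unfolding X_def Y_def
    by (intro mset_le_sum[OF idl C] mset_le_repeat[OF idl] le) simp
  then have "mset_le I (replicate_mset D a + X) (replicate_mset D a + Y)"
    using mset_le_add[OF idl mset_le_if_le[OF idl order_refl]] by blast
  then have "mset_le I (replicate_mset D a + X) (replicate_mset D b + X)"
    using XY by (simp add: add.commute)
  then have "a - b \<in> I"
    using mset_le_cancel[OF idl] mset_le_replicateD[OF I D] by blast
  then show False using d by simp
qed

text \<open>The truncated sum is not linear; the prime ideal decides for each pair which of the two
  linear branches of \<open>min 1 (v x + v y)\<close> is imposed.\<close>

theorem finite_partial_hom:
  fixes a b :: "'a :: divisible_mv_algebra"
  assumes "\<not> a \<le> b" and "finite S" "a \<in> S" "b \<in> S" "finite K"
  obtains v :: "'a \<Rightarrow> rat" where "v b < v a" "v 0 = 0" "v (- 0) = 1"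
    "\<And>x. x \<in> S \<Longrightarrow> 0 \<le> v x \<and> v x \<le> 1"
    "\<And>x. x \<in> S \<Longrightarrow> v (- x) = 1 - v x"
    "\<And>x y. x \<in> S \<Longrightarrow> y \<in> S \<Longrightarrow> v (x + y) = min 1 (v x + v y)"
    "\<And>x k. x \<in> S \<Longrightarrow> k \<in> K \<Longrightarrow> v (dv k x) = v x / of_nat (Suc k)"
proof -
  have "a - b \<noteq> 0" using assms(1) by (simp add: diff_eq_zero_iff)
  then obtain I where I: "prime_ideal I" and d: "a - b \<notin> I"
    using exists_prime_ideal by blast
  then have idl: "ideal I" by (simp add: prime_ideal_def)
  define branch where "branch x y = (if x - (- y) \<in> I then {#x, y#} else {#- 0#})" for x y
  define C where "C = {({#0#}, {#}), ({#}, {#0#})} \<union> (\<lambda>x. ({#}, {#x#})) ` S \<union> (\<lambda>x. ({#x#}, {#- 0#})) ` S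
    \<union> (\<lambda>x. ({#x, - x#}, {#- 0#})) ` S \<union> (\<lambda>x. ({#- 0#}, {#x, - x#})) ` S
    \<union> (\<lambda>(x, y). ({#x + y#}, {#x, y#})) ` (S \<times> S) \<union> (\<lambda>(x, y). ({#x + y#}, {#- 0#})) ` (S \<times> S)
    \<union> (\<lambda>(x, y). (branch x y, {#x + y#})) ` (S \<times> S)
    \<union> (\<lambda>(x, k). (replicate_mset (Suc k) (dv k x), {#x#})) ` (S \<times> K)
    \<union> (\<lambda>(x, k). ({#x#}, replicate_mset (Suc k) (dv k x))) ` (S \<times> K)"
  have "finite C" using assms unfolding C_def by simp
  moreover have "mset_le I xs ys" if "(xs, ys) \<in> C" for xs ys
  proof -
    have uminus: "mset_le I {#x, - x#} {#- 0#}" "mset_le I {#- 0#} {#x, - x#}" for x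
      by (simp_all add: mset_le_if_le[OF idl] dvsum_uminus)
    have dv: "mset_le I (replicate_mset (Suc k) (dv k x)) {#x#}"
      "mset_le I {#x#} (replicate_mset (Suc k) (dv k x))" for k x
      by (simp_all add: mset_le_if_le[OF idl] dvsum_dv del: replicate_mset_Suc)
    have "mset_le I (branch x y) {#x + y#}" for x y
    proof (cases "x - (- y) \<in> I")
      case True
      then show ?thesis using mset_le_pair_add[OF idl] by (simp add: branch_def)
    next
      case False
      then have "(- y) - x \<in> I" using I by (auto simp: prime_ideal_def)
      then show ?thesis using mset_le_top_add[OF idl] False by (simp add: branch_def)
    qed
    then show ?thesis
      using \<open>(xs, ys) \<in> C\<close> mset_le_zero[OF idl] mset_le_empty[OF idl] mset_le_top[OF idl]
        mset_le_add_pair[OF idl]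
      unfolding C_def by (auto split: if_splits intro: uminus dv simp del: replicate_mset_Suc)
  qed
  ultimately obtain v where v: "v b < v a" and vC: "\<And>xs ys. (xs, ys) \<in> C \<Longrightarrow> msum v xs \<le> msum v ys"
    using separating_functional[OF I d] by blast
  have zero: "v 0 = 0"
    using vC[of "{#0#}" "{#}"] vC[of "{#}" "{#0#}"] by (simp add: C_def)
  have bound: "0 \<le> v x \<and> v x \<le> v (- 0)" if "x \<in> S" for x
    using vC[of "{#}" "{#x#}"] vC[of "{#x#}" "{#- 0#}"] that by (simp add: C_def)
  have um: "v x + v (- x) = v (- 0)" if "x \<in> S" for x
    using vC[of "{#x, - x#}" "{#- 0#}"] vC[of "{#- 0#}" "{#x, - x#}"] that
    by (intro order.antisym) (auto simp: C_def)
  have add: "v (x + y) = min (v (- 0)) (v x + v y)" if "x \<in> S" "y \<in> S" for x y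
  proof -
    have "({#x + y#}, {#x, y#}) \<in> C" "({#x + y#}, {#- 0#}) \<in> C"
      unfolding C_def using that by auto
    from this[THEN vC] have 1: "v (x + y) \<le> v x + v y" "v (x + y) \<le> v (- 0)"
      by simp_all
    have "(branch x y, {#x + y#}) \<in> C"
      unfolding C_def using that by auto
    from vC[OF this] have "v x + v y \<le> v (x + y) \<or> v (- 0) \<le> v (x + y)"
      by (auto simp: branch_def split: if_splits)
    then show ?thesis using 1 by auto
  qed
  have dv: "of_nat (Suc k) * v (dv k x) = v x" if "x \<in> S" "k \<in> K" for x k
  proof -
    have "(replicate_mset (Suc k) (dv k x), {#x#}) \<in> C" "({#x#}, replicate_mset (Suc k) (dv k x)) \<in> C"
      unfolding C_def using that by auto
    from this[THEN vC] show ?thesis by (simp add: algebra_simps)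
  qed
  \<comment> \<open>The constraints are homogeneous, so the value 1 at the top is arranged by
    rescaling. Two distinct values between 0 and \<open>v (- 0)\<close> force the latter to be
    positive.\<close>
  have pos: "v (- 0) > 0" using bound[of a] bound[of b] v assms by auto
  show ?thesis
  proof (rule that[of "\<lambda>x. v x / v (- 0)"])
    fix x y assume "x \<in> S" "y \<in> S"
    then show "v (x + y) / v (- 0) = min 1 (v x / v (- 0) + v y / v (- 0))"
      using pos by (simp add: add min_def field_simps)
  next
    fix x k assume "x \<in> S" "k \<in> K"
    then show "v (dv k x) / v (- 0) = v x / v (- 0) / of_nat (Suc k)"
      using pos dv[of x k] by (simp add: field_simps del: of_nat_Suc)
  qed (use pos v zero bound um in \<open>auto simp: field_simps\<close>)
qed

section \<open>Completeness of the axioms\<close>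

lemma derivable_refl: "derivable Ax t t"
  by (simp add: derivable_def)

lemma derivable_trans [trans]: "derivable Ax t u \<Longrightarrow> derivable Ax u w \<Longrightarrow> derivable Ax t w"
  by (simp add: derivable_def)

lemma deriv_step_sym: "deriv_step Ax t u \<Longrightarrow> deriv_step Ax u t"
proof (induction rule: deriv_step.induct)
  case (replace ax t t')
  then show ?case
    by (intro deriv_step.replace[of ax]) (auto simp: instantiates_def)
qed (auto intro: deriv_step.intros)

lemma derivable_sym: "derivable Ax t u \<Longrightarrow> derivable Ax u t"
  unfolding derivable_def
  by (induction rule: rtranclp_induct) (auto intro: converse_rtranclp_into_rtranclp deriv_step_sym)

lemma derivable_context:
  assumes "\<And>t u. deriv_step Ax t u \<Longrightarrow> deriv_step Ax (f t) (f u)"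
  shows "derivable Ax t u \<Longrightarrow> derivable Ax (f t) (f u)"
  unfolding derivable_def
  by (induction rule: rtranclp_induct) (auto intro: rtranclp.rtrancl_into_rtrancl assms)

lemma derivable_oplus:
  "derivable Ax t t' \<Longrightarrow> derivable Ax u u' \<Longrightarrow> derivable Ax (t \<oplus> u) (t' \<oplus> u')"
  by (rule derivable_trans[OF derivable_context[OF deriv_step.oplus_left]
        derivable_context[OF deriv_step.oplus_right]])

lemma derivable_Neg: "derivable Ax t t' \<Longrightarrow> derivable Ax (Neg t) (Neg t')"
  by (rule derivable_context[OF deriv_step.neg])

lemma derivable_DeltaSuc: "derivable Ax t t' \<Longrightarrow> derivable Ax (DeltaSuc k t) (DeltaSuc k t')"
  by (rule derivable_context[OF deriv_step.delta])

\<comment> \<open>The Lindenbaum algebra: equality of classes is derivability, so completeness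
  becomes a statement about inequalities in one divisible MV-algebra.\<close>
quotient_type lindenbaum = formula / "derivable DMV"
  by (intro equivpI reflpI sympI transpI) (blast intro: derivable_refl derivable_sym derivable_trans)+

lemma derivable_instance:
  "(l, r) \<in> Ax \<Longrightarrow> derivable Ax (subst s l) (subst s r)"
  unfolding derivable_def
  by (rule r_into_rtranclp) (auto intro!: deriv_step.replace simp: instantiates_def)

lemma subst_big_oplus: "subst s (big_oplus ts) = big_oplus (map (subst s) ts)"
  by (induction ts rule: big_oplus.induct) auto

lemma DMV_derivable:
  "derivable DMV (x \<oplus> y) (y \<oplus> x)"
  "derivable DMV (x \<oplus> (y \<oplus> z)) ((x \<oplus> y) \<oplus> z)"
  "derivable DMV (x \<oplus> One) One"
  "derivable DMV (x \<oplus> Zero) x"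
  "derivable DMV (Neg (x \<odot> y)) (Neg x \<oplus> Neg y)"
  "derivable DMV x (Neg (Neg x))"
  "derivable DMV (Neg Zero) One"
  "derivable DMV ((x \<odot> Neg y) \<oplus> y) ((y \<odot> Neg x) \<oplus> x)"
  "derivable DMV (big_oplus (replicate (Suc k) (DeltaSuc k x))) x"
  "derivable DMV (DeltaSuc k x \<odot> big_oplus (replicate k (DeltaSuc k x))) Zero"
proof -
  let ?s = "\<lambda>i :: nat. if i = 0 then x else if i = 1 then y else z"
  have *: "derivable DMV (subst ?s l) (subst ?s r)" if "(l, r) \<in> DMV" for l r
    using that by (rule derivable_instance)
  note MV = DMV_def MV_def Let_def
  show "derivable DMV (x \<oplus> y) (y \<oplus> x)"
    using *[of "Var 0 \<oplus> Var 1" "Var 1 \<oplus> Var 0"] by (simp add: MV)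
  show "derivable DMV (x \<oplus> (y \<oplus> z)) ((x \<oplus> y) \<oplus> z)"
    using *[of "Var 0 \<oplus> (Var 1 \<oplus> Var 2)" "(Var 0 \<oplus> Var 1) \<oplus> Var 2"] by (simp add: MV)
  show "derivable DMV (x \<oplus> One) One"
    using *[of "Var 0 \<oplus> One" One] by (simp add: MV)
  show "derivable DMV (x \<oplus> Zero) x"
    using *[of "Var 0 \<oplus> Zero" "Var 0"] by (simp add: MV)
  show "derivable DMV (Neg (x \<odot> y)) (Neg x \<oplus> Neg y)"
    using *[of "Neg (Var 0 \<odot> Var 1)" "Neg (Var 0) \<oplus> Neg (Var 1)"] by (simp add: MV)
  show "derivable DMV x (Neg (Neg x))"
    using *[of "Var 0" "Neg (Neg (Var 0))"] by (simp add: MV)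
  show "derivable DMV (Neg Zero) One"
    using *[of "Neg Zero" One] by (simp add: MV)
  show "derivable DMV ((x \<odot> Neg y) \<oplus> y) ((y \<odot> Neg x) \<oplus> x)"
    using *[of "(Var 0 \<odot> Neg (Var 1)) \<oplus> Var 1" "(Var 1 \<odot> Neg (Var 0)) \<oplus> Var 0"] by (simp add: MV)
  have "(big_oplus (replicate (Suc k) (DeltaSuc k (Var 0))), Var 0) \<in> DMV"
    "(DeltaSuc k (Var 0) \<odot> big_oplus (replicate k (DeltaSuc k (Var 0))), Zero) \<in> DMV"
    unfolding DMV_def by blast+
  from this[THEN *] show "derivable DMV (big_oplus (replicate (Suc k) (DeltaSuc k x))) x"
    "derivable DMV (DeltaSuc k x \<odot> big_oplus (replicate k (DeltaSuc k x))) Zero"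
    by (simp_all add: subst_big_oplus del: replicate_Suc)
qed

instantiation lindenbaum :: mv_algebra
begin

lift_definition zero_lindenbaum :: lindenbaum is Zero .

lift_definition plus_lindenbaum :: "lindenbaum \<Rightarrow> lindenbaum \<Rightarrow> lindenbaum" is Oplus
  by (rule derivable_oplus)

lift_definition uminus_lindenbaum :: "lindenbaum \<Rightarrow> lindenbaum" is Neg
  by (rule derivable_Neg)

definition minus_lindenbaum :: "lindenbaum \<Rightarrow> lindenbaum \<Rightarrow> lindenbaum" where
  "x - y = - (- x + y)" for x y :: lindenbaum

definition less_eq_lindenbaum :: "lindenbaum \<Rightarrow> lindenbaum \<Rightarrow> bool" where
  "x \<le> y \<longleftrightarrow> - x + y = - 0" for x y :: lindenbaum

definition less_lindenbaum :: "lindenbaum \<Rightarrow> lindenbaum \<Rightarrow> bool" where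
  "x < y \<longleftrightarrow> x \<le> y \<and> x \<noteq> y" for x y :: lindenbaum

lemma abs_One: "abs_lindenbaum One = - 0"
  unfolding zero_lindenbaum_def uminus_lindenbaum.abs_eq lindenbaum.abs_eq_iff
  by (rule derivable_sym[OF DMV_derivable(7)])

lemma lindenbaum_uminus_uminus: "- (- x) = x" for x :: lindenbaum
  by transfer (rule derivable_sym[OF DMV_derivable(6)])

text \<open>De Morgan and double negation express \<open>\<odot>\<close> by sum and negation, the
  operations that the class provides.\<close>

lemma abs_Odot: "abs_lindenbaum (t \<odot> u) = - (- abs_lindenbaum t + - abs_lindenbaum u)"
proof -
  have "- abs_lindenbaum (t \<odot> u) = - abs_lindenbaum t + - abs_lindenbaum u"
    unfolding plus_lindenbaum.abs_eq uminus_lindenbaum.abs_eq lindenbaum.abs_eq_iff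
    by (rule DMV_derivable)
  then show ?thesis by (metis lindenbaum_uminus_uminus)
qed

instance proof (intro_classes)
  fix x y z :: lindenbaum
  show comm: "x + y = y + x" for x y :: lindenbaum by transfer (rule DMV_derivable)
  show "x + y + z = x + (y + z)" by transfer (rule derivable_sym[OF DMV_derivable(2)])
  show "0 + x = x" unfolding comm[of 0 x] by transfer (rule DMV_derivable)
  show "- (- x) = x" by (rule lindenbaum_uminus_uminus)
  show "x + - 0 = - 0"
    unfolding abs_One[symmetric] by (induction x, unfold plus_lindenbaum.abs_eq lindenbaum.abs_eq_iff) (rule DMV_derivable)
  show "- (- x + y) + y = - (- y + x) + x"
  proof (induction x, induction y)
    fix t u
    let ?x = "abs_lindenbaum t" and ?y = "abs_lindenbaum u"
    have "abs_lindenbaum ((t \<odot> Neg u) \<oplus> u) = abs_lindenbaum ((u \<odot> Neg t) \<oplus> t)"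
      unfolding lindenbaum.abs_eq_iff by (rule DMV_derivable)
    then show "- (- ?x + ?y) + ?y = - (- ?y + ?x) + ?x"
      unfolding plus_lindenbaum.abs_eq[symmetric] abs_Odot uminus_lindenbaum.abs_eq[symmetric] lindenbaum_uminus_uminus .
  qed
qed (rule minus_lindenbaum_def less_eq_lindenbaum_def less_lindenbaum_def)+

end

lemma abs_big_oplus_replicate: "abs_lindenbaum (big_oplus (replicate k t)) = nmul k (abs_lindenbaum t)"
proof (induction k)
  case 0
  show ?case by (simp add: zero_lindenbaum_def)
next
  case (Suc k)
  then show ?case by (cases k) (auto simp: plus_lindenbaum.abs_eq[symmetric] zero_lindenbaum_def[symmetric])
qed

instantiation lindenbaum :: divisible_mv_algebra
begin

lift_definition dv_lindenbaum :: "nat \<Rightarrow> lindenbaum \<Rightarrow> lindenbaum" is DeltaSuc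
  by (rule derivable_DeltaSuc)

instance proof
  fix k and x :: lindenbaum
  show "nmul (Suc k) (dv k x) = x"
  proof (induction x)
    fix t
    show "nmul (Suc k) (dv k (abs_lindenbaum t)) = abs_lindenbaum t"
      unfolding dv_lindenbaum.abs_eq abs_big_oplus_replicate[symmetric] lindenbaum.abs_eq_iff
      by (rule DMV_derivable)
  qed
  show "perp (dv k x) (nmul k (dv k x))"
  proof (induction x)
    fix t
    let ?y = "abs_lindenbaum (DeltaSuc k t)"
    have "- (- ?y + - nmul k ?y) = 0"
      unfolding abs_big_oplus_replicate[symmetric] abs_Odot[symmetric] zero_lindenbaum_def
        lindenbaum.abs_eq_iff
      by (rule DMV_derivable)
    then have "- ?y + - nmul k ?y = - 0" by (metis uminus_uminus)
    then show "perp (dv k (abs_lindenbaum t)) (nmul k (dv k (abs_lindenbaum t)))"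
      by (simp add: dv_lindenbaum.abs_eq perp_def less_eq_def)
  qed
qed

end

section \<open>Truth functions and completeness\<close>

primrec eval :: "(nat \<Rightarrow> real) \<Rightarrow> formula \<Rightarrow> real" where
  "eval v (Var i) = v i"
| "eval v Zero = 0"
| "eval v One = 1"
| "eval v (t \<oplus> u) = min 1 (eval v t + eval v u)"
| "eval v (t \<odot> u) = max 0 (eval v t + eval v u - 1)"
| "eval v (Neg t) = 1 - eval v t"
| "eval v (DeltaSuc k t) = eval v t / real (Suc k)"

primrec subformulas :: "formula \<Rightarrow> formula set" where
  "subformulas (Var i) = {Var i}"
| "subformulas Zero = {Zero}"
| "subformulas One = {One}"
| "subformulas (t \<oplus> u) = insert (t \<oplus> u) (subformulas t \<union> subformulas u)"
| "subformulas (t \<odot> u) = insert (t \<odot> u) (subformulas t \<union> subformulas u)"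
| "subformulas (Neg t) = insert (Neg t) (subformulas t)"
| "subformulas (DeltaSuc k t) = insert (DeltaSuc k t) (subformulas t)"

lemma finite_subformulas: "finite (subformulas t)"
  by (induction t) auto

lemma self_in_subformulas: "t \<in> subformulas t"
  by (cases t) auto

lemma of_rat_min: "(of_rat (min a b) :: 'a :: linordered_field) = min (of_rat a) (of_rat b)"
  by (simp add: min_def of_rat_less_eq)

lemma of_rat_max: "(of_rat (max a b) :: 'a :: linordered_field) = max (of_rat a) (of_rat b)"
  by (simp add: max_def of_rat_less_eq)

text \<open>A failure of the inequality is witnessed by a rational valuation on finitely many
  classes. Its values at the variables form an assignment under which every subformula evaluates to
  the value of its class.\<close>

lemma abs_le_if_eval_le:
  assumes "\<And>v. (\<And>i. 0 \<le> v i \<and> v i \<le> 1) \<Longrightarrow> eval v t \<le> eval v u"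
  shows "abs_lindenbaum t \<le> abs_lindenbaum u"
proof (rule ccontr)
  assume neg: "\<not> ?thesis"
  define F where "F = subformulas t \<union> subformulas u"
  define X where "X = abs_lindenbaum ` F"
  \<comment> \<open>The value of \<open>f \<odot> g\<close> is computed through
    \<open>- (- x + - y)\<close>, so the valuation must be controlled on the negations in
    \<open>Y\<close> and on their sums in \<open>S\<close>.\<close>
  define Y where "Y = X \<union> uminus ` X"
  define S where "S = Y \<union> (\<lambda>(x, y). x + y) ` (Y \<times> Y)"
  \<comment> \<open>The default 0 only enlarges \<open>K\<close>, which stays a finite image of
    \<open>F\<close>.\<close>
  define K where "K = (\<lambda>f. case f of DeltaSuc k t \<Rightarrow> k | _ \<Rightarrow> 0) ` F"
  have fin: "finite F" "finite S" "finite K"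
    by (auto simp: F_def X_def Y_def S_def K_def finite_subformulas)
  have X: "abs_lindenbaum f \<in> X" if "subformulas f \<subseteq> F" for f
    using that self_in_subformulas by (auto simp: X_def)
  have tu: "abs_lindenbaum t \<in> S" "abs_lindenbaum u \<in> S"
    using X[of t] X[of u] by (auto simp: F_def S_def Y_def)
  obtain v :: "lindenbaum \<Rightarrow> rat" where less: "v (abs_lindenbaum u) < v (abs_lindenbaum t)"
    and zero: "v 0 = 0" and one: "v (- 0) = 1"
    and bound: "\<And>x. x \<in> S \<Longrightarrow> 0 \<le> v x \<and> v x \<le> 1"
    and um: "\<And>x. x \<in> S \<Longrightarrow> v (- x) = 1 - v x"
    and add: "\<And>x y. x \<in> S \<Longrightarrow> y \<in> S \<Longrightarrow> v (x + y) = min 1 (v x + v y)"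
    and dv: "\<And>x k. x \<in> S \<Longrightarrow> k \<in> K \<Longrightarrow> v (dv k x) = v x / of_nat (Suc k)"
    by (rule finite_partial_hom[OF neg fin(2) tu fin(3)]) (rule that)
  \<comment> \<open>Nothing bounds \<open>v\<close> outside \<open>S\<close>; variables outside
    \<open>F\<close> get the value 0 so that the assignment stays in the unit interval.\<close>
  define w where "w i = (if Var i \<in> F then real_of_rat (v (abs_lindenbaum (Var i))) else 0)" for i
  have w: "0 \<le> w i \<and> w i \<le> 1" for i
    using bound by (auto simp: w_def S_def Y_def X_def)
  have ev: "eval w f = real_of_rat (v (abs_lindenbaum f))" if "subformulas f \<subseteq> F" for f
    using that
  proof (induction f)
    case (Var i)
    then show ?case by (simp add: w_def)
  next
    case Zero
    then show ?case using zero by (simp add: zero_lindenbaum_def)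
  next
    case One
    then show ?case using one by (simp add: abs_One)
  next
    case (Oplus f g)
    then have "abs_lindenbaum f \<in> S" "abs_lindenbaum g \<in> S"
      using X[of f] X[of g] by (auto simp: S_def Y_def)
    then show ?case
      using Oplus by (simp add: plus_lindenbaum.abs_eq[symmetric] add of_rat_min of_rat_add)
  next
    case (Odot f g)
    let ?x = "abs_lindenbaum f" and ?y = "abs_lindenbaum g"
    have "?x \<in> S" "?y \<in> S" "- ?x \<in> S" "- ?y \<in> S" "- ?x + - ?y \<in> S"
      using X[of f] X[of g] Odot.prems by (auto simp: S_def Y_def)
    then have "v (abs_lindenbaum (f \<odot> g)) = max 0 (v ?x + v ?y - 1)"
      by (simp add: abs_Odot um add)
    then show ?case
      using Odot by (simp add: of_rat_max of_rat_add of_rat_diff)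
  next
    case (Neg f)
    then have "abs_lindenbaum f \<in> S" using X[of f] by (auto simp: S_def Y_def)
    then show ?case using Neg by (simp add: uminus_lindenbaum.abs_eq[symmetric] um of_rat_diff)
  next
    case (DeltaSuc k f)
    then have "abs_lindenbaum f \<in> S" using X[of f] by (auto simp: S_def Y_def)
    moreover have "k \<in> K"
      using DeltaSuc.prems unfolding K_def by (intro image_eqI[of _ _ "DeltaSuc k f"]) auto
    ultimately show ?case
      using DeltaSuc by (simp add: dv_lindenbaum.abs_eq[symmetric] dv of_rat_divide of_rat_add)
  qed
  have "eval w u < eval w t"
    using less ev[of t] ev[of u] by (simp add: F_def of_rat_less)
  then show False using assms[of w] w by simp
qed

theorem DMV_complete:
  assumes "\<And>v. (\<And>i. 0 \<le> v i \<and> v i \<le> 1) \<Longrightarrow> eval v t = eval v u"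
  shows "derivable DMV t u"
proof -
  have "abs_lindenbaum t = abs_lindenbaum u"
    using abs_le_if_eval_le[of t u] abs_le_if_eval_le[of u t] assms by (simp add: order.antisym)
  then show ?thesis by (simp add: lindenbaum.abs_eq_iff)
qed

section \<open>Truth functions of extracted formulae\<close>

lemma nth_cube: "x \<in> cube n \<Longrightarrow> i < n \<Longrightarrow> 0 \<le> x ! i \<and> x ! i \<le> 1"
  by (auto simp: cube_def) (meson atLeastAtMost_iff nth_mem subsetD)+

lemma map_upt_in_cube: "(\<And>i. i < n \<Longrightarrow> 0 \<le> v i \<and> v i \<le> 1) \<Longrightarrow> map v [0..<n] \<in> cube n"
  by (auto simp: cube_def)

lemma cube_nonempty: "cube n \<noteq> {}"
  using map_upt_in_cube[of n "\<lambda>i. 0"] by auto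

lemma affine_bounded:
  assumes "x \<in> cube (length ms)"
  shows "\<bar>affine ms b x\<bar> \<le> (\<Sum>i<length ms. \<bar>of_int (ms ! i)\<bar>) + \<bar>of_int b\<bar>"
proof -
  have "\<bar>of_int (ms ! i) * x ! i\<bar> \<le> \<bar>of_int (ms ! i)\<bar>" if "i < length ms" for i
    using nth_cube[OF assms that] by (simp add: abs_mult mult_left_le)
  then have "\<bar>\<Sum>i<length ms. of_int (ms ! i) * x ! i\<bar> \<le> (\<Sum>i<length ms. \<bar>of_int (ms ! i)\<bar>)"
    by (intro order.trans[OF sum_abs] sum_mono) auto
  then show ?thesis unfolding affine_def by linarith
qed

lemma affine_min_le: "x \<in> cube (length ms) \<Longrightarrow> affine_min ms b \<le> affine ms b x"
  unfolding affine_min_def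
proof (rule cInf_lower)
  show "bdd_below (affine ms b ` cube (length ms))"
    using affine_bounded[of _ ms b]
    by (intro bdd_belowI2[of _ "- ((\<Sum>i<length ms. \<bar>of_int (ms ! i)\<bar>) + \<bar>of_int b\<bar>)"])
      (meson abs_le_D2 minus_le_iff)
qed auto

lemma le_affine_max: "x \<in> cube (length ms) \<Longrightarrow> affine ms b x \<le> affine_max ms b"
  unfolding affine_max_def
proof (rule cSup_upper)
  show "bdd_above (affine ms b ` cube (length ms))"
    using affine_bounded[of _ ms b] by (meson abs_le_D1 bdd_aboveI2)
qed auto

lemma affine_update:
  assumes "k < length ms"
  shows "affine (ms[k := ms ! k - 1]) b x = affine ms b x - x ! k"
proof -
  have "(\<Sum>i<length ms. of_int (ms[k := ms ! k - 1] ! i) * x ! i)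
      = (\<Sum>i<length ms. of_int (ms ! i) * x ! i - (if i = k then x ! k else 0))"
    by (intro sum.cong) (auto simp: algebra_simps)
  also have "\<dots> = (\<Sum>i<length ms. of_int (ms ! i) * x ! i) - x ! k"
    using assms by (simp add: sum_subtractf)
  finally show ?thesis by (simp add: affine_def)
qed

lemma affine_uminus: "affine (map uminus ms) (1 - b) x = 1 - affine ms b x"
  by (simp add: affine_def sum_negf)

text \<open>The function is the constant \<open>b\<close>, and no integer lies strictly between 0
  and 1; this later excludes the case \<open>None\<close> in \<open>extr\<close>.\<close>

lemma affine_first_nonzero_None:
  assumes "first_nonzero ms = None"
  shows "affine_min ms b = of_int b" "affine_max ms b = of_int b"
proof -
  have "ms ! i = 0" if "i < length ms" for i
    using assms that by (auto simp: first_nonzero_def find_None_iff)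
  then have "affine ms b x = of_int b" for x by (simp add: affine_def)
  then have "affine ms b ` cube (length ms) = {of_int b}"
    using cube_nonempty by auto
  then show "affine_min ms b = of_int b" "affine_max ms b = of_int b"
    by (simp_all add: affine_min_def affine_max_def)
qed

lemma eval_oplus_simp: "eval v u \<le> 1 \<Longrightarrow> eval v (oplus_simp t u) = min 1 (eval v t + eval v u)"
  by (simp add: oplus_simp_def)

lemma eval_odot_simp: "0 \<le> eval v t \<Longrightarrow> eval v (odot_simp t u) = max 0 (eval v t + eval v u - 1)"
  by (simp add: odot_simp_def)

lemma clip_bounds: "0 \<le> clip y" "clip y \<le> 1"
  by (auto simp: clip_def)

text \<open>With \<open>z = y - t\<close>, one of the clips is constant: for
  \<open>z \<le> 0\<close> the first is 0, for \<open>z \<ge> 0\<close> the second is 1. Either way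
  the outer bounds leave \<open>clip (z + t)\<close>.\<close>

lemma clip_recursion:
  "0 \<le> t \<Longrightarrow> t \<le> 1 \<Longrightarrow> max 0 (min 1 (clip (y - t) + t) + clip (y - t + 1) - 1) = clip y"
  by (auto simp: clip_def min_def max_def)

lemma eval_extr:
  assumes "\<And>i. i < length ms \<Longrightarrow> 0 \<le> v i \<and> v i \<le> 1"
  shows "eval v (extr ms b) = clip (affine ms b (map v [0..<length ms]))"
  using assms
proof (induction ms b rule: extr.induct)
  case (1 ms b)
  let ?x = "map v [0..<length ms]"
  have x: "?x \<in> cube (length ms)" using 1(4) by (rule map_upt_in_cube)
  consider "affine_min ms b \<ge> 1" | "\<not> affine_min ms b \<ge> 1" "affine_max ms b \<le> 0"
    | "\<not> affine_min ms b \<ge> 1" "\<not> affine_max ms b \<le> 0" by blast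
  then show ?case
  proof cases
    case 1
    then show ?thesis using affine_min_le[OF x, of b] by (simp add: extr.simps[of ms b] clip_def)
  next
    case 2
    then show ?thesis using le_affine_max[OF x, of b] by (simp add: extr.simps[of ms b] clip_def)
  next
    case 3
    then have "of_int b < (1 :: real)" "of_int b > (0 :: real)" if "first_nonzero ms = None"
      using affine_first_nonzero_None[OF that, of b] by simp_all
    then obtain k where k: "first_nonzero ms = Some k" by fastforce
    then have len: "k < length ms" using first_nonzero_SomeD by blast
    show ?thesis
    proof (cases "ms ! k \<ge> 1")
      case True
      let ?ms = "ms[k := ms ! k - 1]"
      have upd: "affine ?ms b ?x = affine ms b ?x - v k"
        "affine ?ms (b + 1) ?x = affine ms b ?x - v k + 1"
        unfolding affine_update[OF len] using len by (simp_all add: affine_def)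
      have "eval v (extr ?ms b) = clip (affine ms b ?x - v k)"
        "eval v (extr ?ms (b + 1)) = clip (affine ms b ?x - v k + 1)"
        using 1(1)[OF 3 k True] 1(2)[OF 3 k True] 1(4) upd by simp_all
      moreover have vk: "0 \<le> v k" "v k \<le> 1" using 1(4)[OF len] by auto
      moreover have "extr ms b = odot_simp (oplus_simp (extr ?ms b) (Var k)) (extr ?ms (b + 1))"
        using 3 k True by (simp add: extr.simps[of ms b])
      ultimately show ?thesis
        by (simp add: eval_odot_simp eval_oplus_simp clip_recursion clip_bounds)
    next
      case False
      then have "extr ms b = Neg (extr (map uminus ms) (1 - b))"
        using 3 k by (simp add: extr.simps[of ms b])
      moreover have "eval v (extr (map uminus ms) (1 - b)) = clip (1 - affine ms b ?x)"
        using 1(3)[OF 3 k False] 1(4) by (simp add: affine_uminus)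
      ultimately show ?thesis by (auto simp: clip_def min_def max_def)
    qed
  qed
qed

section \<open>Node formulae with rational coefficients\<close>

lemma denominator:
  assumes "r \<in> \<rat>"
  shows "denominator r > 0" "real (denominator r) * r \<in> \<int>"
proof -
  from assms obtain q where q: "r = of_rat q" by (auto elim: Rats_cases)
  then have the: "(THE q. of_rat q = r) = q" by auto
  obtain a b where ab: "quotient_of q = (a, b)" by (cases "quotient_of q")
  then have "b > 0" "q = of_int a / of_int b" by (auto simp: quotient_of_denom_pos quotient_of_div)
  moreover have "denominator r = nat b" by (simp add: denominator_def the ab)
  ultimately have "real (denominator r) * r = of_int a" "denominator r > 0"
    by (auto simp: q of_rat_divide)
  then show "denominator r > 0" "real (denominator r) * r \<in> \<int>" by auto
qed

lemma common_denominator: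
  assumes "set (weights v) \<subseteq> \<rat>" "bias v \<in> \<rat>"
  shows "common_denominator v > 0"
    and "w \<in> insert (bias v) (set (weights v)) \<Longrightarrow>
      of_int \<lfloor>real (common_denominator v) * w\<rfloor> = real (common_denominator v) * w"
proof -
  let ?A = "insert (bias v) (set (weights v))"
  have rat: "w \<in> \<rat>" if "w \<in> ?A" for w using assms that by auto
  show "common_denominator v > 0"
    unfolding common_denominator_def using denominator(1)[OF rat]
    by (intro Nat.gr0I) (fastforce simp: Lcm_0_iff)
  assume w: "w \<in> ?A"
  then have "denominator w dvd common_denominator v"
    unfolding common_denominator_def by (intro dvd_Lcm) auto
  then obtain m where "common_denominator v = m * denominator w" by (metis dvd_def mult.commute)
  then have "real (common_denominator v) * w = of_nat m * (real (denominator w) * w)" by simp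
  also have "\<dots> \<in> \<int>" by (rule Ints_mult[OF Ints_of_nat denominator(2)[OF rat[OF w]]])
  finally show "of_int \<lfloor>real (common_denominator v) * w\<rfloor> = real (common_denominator v) * w"
    by (auto elim: Ints_cases)
qed

text \<open>The terms cut \<open>y\<close> into consecutive slices of height one. This one identity
  serves both the splitting of nodes and the disjunction over a common denominator.\<close>

lemma sum_clip_shift: "(\<Sum>i<n. clip (y - real i)) = max 0 (min (real n) y)"
  by (induction n) (auto simp: clip_def)

lemma eval_big_oplus:
  "(\<And>t. t \<in> set ts \<Longrightarrow> 0 \<le> eval v t \<and> eval v t \<le> 1) \<Longrightarrow>
    eval v (big_oplus ts) = min 1 (\<Sum>t\<leftarrow>ts. eval v t)"
proof (induction ts rule: big_oplus.induct)
  case (3 t u ts)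
  have "min 1 (a + min 1 b) = min 1 (a + b)" if "0 \<le> a" for a b :: real
    using that by (auto simp: min_def)
  moreover have "eval v (big_oplus (u # ts)) = min 1 (\<Sum>t\<leftarrow>u # ts. eval v t)" "0 \<le> eval v t"
    using 3 by auto
  ultimately show ?case by simp
qed auto

text \<open>Scaling by \<open>s\<close> makes the affine function integral. The formulas from
  \<open>extr\<close> realize the \<open>s\<close> unit slices of \<open>s * z\<close>; divided by
  \<open>s\<close>, they add up to the clipped \<open>z\<close>.\<close>

lemma eval_node_formula:
  assumes rat: "set (weights u) \<subseteq> \<rat>" "bias u \<in> \<rat>"
    and v: "\<And>i. i < length (weights u) \<Longrightarrow> 0 \<le> v i \<and> v i \<le> 1"
  shows "eval v (node_formula u) =
    clip ((\<Sum>i<length (weights u). weights u ! i * map v [0..<length (weights u)] ! i) + bias u)"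
proof -
  define s where "s = common_denominator u"
  define z where "z = (\<Sum>i<length (weights u). weights u ! i * map v [0..<length (weights u)] ! i) + bias u"
  define f where "f i = DeltaSuc (s - 1)
    (extr (map (\<lambda>w. \<lfloor>real s * w\<rfloor>) (weights u)) (\<lfloor>real s * bias u\<rfloor> - int i))" for i
  have s: "s > 0" unfolding s_def by (rule common_denominator(1)[OF rat])
  let ?n = "length (weights u)" and ?x = "map v [0..<length (weights u)]"
  have "of_int \<lfloor>real s * weights u ! i\<rfloor> = real s * weights u ! i" if "i < ?n" for i
    unfolding s_def using that by (intro common_denominator(2)[OF rat]) auto
  then have "(\<Sum>i<?n. of_int (map (\<lambda>w. \<lfloor>real s * w\<rfloor>) (weights u) ! i) * ?x ! i)
      = (\<Sum>i<?n. real s * (weights u ! i * ?x ! i))"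
    by (intro sum.cong) simp_all
  moreover have "of_int \<lfloor>real s * bias u\<rfloor> = real s * bias u"
    unfolding s_def by (rule common_denominator(2)[OF rat]) simp
  ultimately have "affine (map (\<lambda>w. \<lfloor>real s * w\<rfloor>) (weights u)) (\<lfloor>real s * bias u\<rfloor> - int i) ?x
      = real s * z - real i" for i
    by (simp only: affine_def length_map z_def of_int_diff of_int_of_nat_eq distrib_left sum_distrib_left[symmetric])
  then have "eval v (extr (map (\<lambda>w. \<lfloor>real s * w\<rfloor>) (weights u)) (\<lfloor>real s * bias u\<rfloor> - int i))
      = clip (real s * z - real i)" for i
    using eval_extr[of "map (\<lambda>w. \<lfloor>real s * w\<rfloor>) (weights u)" v "\<lfloor>real s * bias u\<rfloor> - int i"] v
    by simp
  then have f: "eval v (f i) = clip (real s * z - real i) / real s" for i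
    using s by (simp add: f_def del: of_nat_Suc)
  then have "eval v (big_oplus (map f [0..<s])) = min 1 (\<Sum>i<s. clip (real s * z - real i) / real s)"
    using s clip_bounds order.trans[OF clip_bounds(2), of "real s"]
    by (subst eval_big_oplus) (auto simp: o_def atLeast0LessThan interv_sum_list_conv_sum_set_nat)
  also have "\<dots> = min 1 (max 0 (min (real s) (real s * z)) / real s)"
    by (simp add: sum_divide_distrib[symmetric] sum_clip_shift)
  also have "\<dots> = clip z"
    using s by (auto simp: clip_def min_def max_def field_simps zero_le_mult_iff mult_le_0_iff)
  also have "node_formula u = big_oplus (map f [0..<s])"
    by (simp add: node_formula_def s_def f_def[abs_def] Let_def)
  ultimately show ?thesis by (simp add: z_def)
qed

section \<open>Conversion into clipped networks\<close>

definition dot :: "real list \<Rightarrow> real list \<Rightarrow> real" where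
  "dot ws x = (\<Sum>(w, y)\<leftarrow>zip ws x. w * y)"

lemma dot_eq_sum: "length x = length ws \<Longrightarrow> dot ws x = (\<Sum>i<length ws. ws ! i * x ! i)"
  by (simp add: dot_def sum_list_sum_nth atLeast0LessThan)

lemma dot_Cons [simp]: "dot [] x = 0" "dot (w # ws) (y # x) = w * y + dot ws x"
  by (simp_all add: dot_def)

lemma dot_append: "length x = length ws \<Longrightarrow> dot (ws @ ws') (x @ x') = dot ws x + dot ws' x'"
  by (simp add: dot_def)

lemma dot_replicate: "dot (replicate (length x) w) x = w * sum_list x"
  by (induction x) (auto simp: algebra_simps)

lemma local_map_eq_dot:
  "length x = length (weights u) \<Longrightarrow> local_map u x = act u (dot (weights u) x + bias u)"
  by (simp add: local_map_def dot_eq_sum)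

text \<open>Copies of a parent carry equal weights, so a node sees only the sum of their
  values.\<close>

lemma dot_concat_replicate:
  "length ws = length xs \<Longrightarrow>
    dot (concat (map2 replicate (map length xs) ws)) (concat xs) = dot ws (map sum_list xs)"
  by (induction ws xs rule: list_induct2) (auto simp: dot_append dot_replicate)

lemma length_concat_replicate:
  "length ws = length ks \<Longrightarrow> length (concat (map2 replicate ks ws)) = sum_list ks"
  by (induction ws ks rule: list_induct2) auto

lemma dot_le:
  "length x = length ws \<Longrightarrow> set x \<subseteq> {0..1} \<Longrightarrow> dot ws x \<le> (\<Sum>w\<leftarrow>ws. max w 0)"
proof (induction x ws rule: list_induct2)
  case (Cons y x w ws)
  then have "w * y \<le> max w 0"
    by (auto simp: max_def mult_left_le mult_nonpos_nonneg)
  then show ?case using Cons by auto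
qed simp

lemma node_bound_le_copies: "node_bound u \<le> real (copies u)"
  by (auto simp: copies_def)

text \<open>Inputs in the unit interval keep the argument at most \<open>node_bound u\<close>, hence
  at most the number of copies, so the slices recover the ReLU value in full.\<close>

lemma sum_local_map_split_node:
  assumes "length x = length (weights u)" "set x \<subseteq> {0..1}"
  shows "(\<Sum>u'\<leftarrow>split_node u. local_map u' x) = relu (dot (weights u) x + bias u)"
proof -
  let ?z = "dot (weights u) x + bias u"
  have "(\<Sum>u'\<leftarrow>split_node u. local_map u' x) = (\<Sum>i<copies u. clip (?z - real i))"
    using assms by (simp add: split_node_def local_map_eq_dot o_def interv_sum_list_conv_sum_set_nat
        atLeast0LessThan algebra_simps)
  moreover have "?z \<le> real (copies u)"
    using dot_le[OF assms] node_bound_le_copies[of u] by (simp add: node_bound_def)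
  ultimately show ?thesis by (simp add: sum_clip_shift relu_def)
qed

definition propagate :: "node list list \<Rightarrow> real list \<Rightarrow> real list" where
  "propagate = fold (\<lambda>l y. map (\<lambda>u. local_map u y) l)"

lemma propagate_simps [simp]:
  "propagate [] x = x" "propagate (l # ls) x = propagate ls (map (\<lambda>u. local_map u x) l)"
  by (simp_all add: propagate_def)

definition node_ok :: "(real \<Rightarrow> real) \<Rightarrow> nat \<Rightarrow> node \<Rightarrow> bool" where
  "node_ok h m u \<longleftrightarrow>
    act u = h \<and> length (weights u) = m \<and> set (weights u) \<subseteq> \<rat> \<and> bias u \<in> \<rat>"

text \<open>Recursive form of the network conditions, suited to induction over levels:
  \<open>h\<close> is the activation of hidden nodes, \<open>h'\<close> that of output nodes,
  \<open>m\<close> the number of inputs. Nonemptiness of the last level gives \<open>hd\<close> a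
  meaning there.\<close>

fun layers_ok :: "(real \<Rightarrow> real) \<Rightarrow> (real \<Rightarrow> real) \<Rightarrow> nat \<Rightarrow> node list list \<Rightarrow> bool" where
  "layers_ok h h' m [] \<longleftrightarrow> False"
| "layers_ok h h' m [l] \<longleftrightarrow> l \<noteq> [] \<and> (\<forall>u\<in>set l. node_ok h' m u)"
| "layers_ok h h' m (l # l' # ls) \<longleftrightarrow>
    (\<forall>u\<in>set l. node_ok h m u) \<and> layers_ok h h' (length l) (l' # ls)"

lemma layers_okI:
  assumes "ls \<noteq> []" "last ls \<noteq> []"
    and "\<And>j u. j < length ls \<Longrightarrow> u \<in> set (ls ! j) \<Longrightarrow>
      node_ok (if Suc j = length ls then h' else h) (if j = 0 then m else length (ls ! (j - 1))) u"
  shows "layers_ok h h' m ls"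
  using assms
proof (induction h h' m ls rule: layers_ok.induct)
  case (2 h h' m l)
  then show ?case using 2(3)[of 0] by auto
next
  case (3 h h' m l l' ls)
  have "layers_ok h h' (length l) (l' # ls)"
  proof (rule 3(1))
    fix j u assume "j < length (l' # ls)" "u \<in> set ((l' # ls) ! j)"
    then show "node_ok (if Suc j = length (l' # ls) then h' else h)
        (if j = 0 then length l else length ((l' # ls) ! (j - 1))) u"
      using 3(4)[of "Suc j" u] by (cases j) auto
  qed (use 3(3) in auto)
  then show ?case using 3(4)[of 0] by auto
qed simp

lemma node_ok_expand_weights:
  assumes "node_ok h (length ks) u"
  shows "node_ok h (sum_list ks) (expand_weights ks u)"
proof -
  have "set (concat (map2 replicate ks (weights u))) \<subseteq> set (weights u)"
    by (auto dest: set_zip_rightD)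
  then show ?thesis
    using assms by (auto simp: node_ok_def expand_weights_def length_concat_replicate)
qed

lemma node_ok_act: "node_ok h m u \<Longrightarrow> node_ok h' m (u\<lparr>act := h'\<rparr>)"
  by (simp add: node_ok_def)

lemma node_ok_split_node: "node_ok h m u \<Longrightarrow> u' \<in> set (split_node u) \<Longrightarrow> node_ok clip m u'"
  by (auto simp: node_ok_def split_node_def)

lemma layers_ok_clip_layers:
  "layers_ok h h' (length ks) ls \<Longrightarrow> layers_ok clip clip (sum_list ks) (clip_layers ks ls)"
proof (induction ks ls rule: clip_layers.induct)
  case (2 ks l)
  then show ?case by (auto intro!: node_ok_act[of h'] node_ok_expand_weights)
next
  case (3 ks l l' ls)
  let ?vs = "map (expand_weights ks) l"
  have "layers_ok clip clip (sum_list (map copies ?vs)) (clip_layers (map copies ?vs) (l' # ls))"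
    using 3 by simp
  moreover have "length (concat (map split_node ?vs)) = sum_list (map copies ?vs)"
    by (simp add: length_concat o_def split_node_def)
  moreover have "node_ok clip (sum_list ks) u" if "u \<in> set (concat (map split_node ?vs))" for u
    using that 3(2) by (auto intro: node_ok_split_node node_ok_expand_weights)
  ultimately show ?case
    by (cases "clip_layers (map copies ?vs) (l' # ls)") (auto simp: Let_def)
qed simp

text \<open>Invariant of the conversion: \<open>xs ! i\<close> lists the values of the copies of the
  \<open>i\<close>-th node, and their sum is its value in the original network. Each copy stays in
  the unit interval although the sum may exceed 1.\<close>

lemma propagate_clip_layers:
  assumes "layers_ok relu id (length xs) ls" "set (concat xs) \<subseteq> {0..1}"
  shows "propagate (clip_layers (map length xs) ls) (concat xs)
    = map clip (propagate ls (map sum_list xs))"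
  using assms
proof (induction "map length xs" ls arbitrary: xs rule: clip_layers.induct)
  case (2 l)
  have "local_map ((expand_weights (map length xs) u)\<lparr>act := clip\<rparr>) (concat xs)
      = clip (local_map u (map sum_list xs))" if "u \<in> set l" for u
    using 2 that length_concat[of xs] by (auto simp: node_ok_def local_map_eq_dot expand_weights_def
        length_concat_replicate dot_concat_replicate)
  then show ?case by simp
next
  case (3 l l' ls)
  let ?vs = "map (expand_weights (map length xs)) l" and ?y = "concat xs"
  define ys where "ys = map (\<lambda>u. map (\<lambda>u'. local_map u' ?y) (split_node u)) ?vs"
  have ok: "node_ok relu (length xs) u" if "u \<in> set l" for u using 3 that by auto
  have len: "map length ys = map copies ?vs"
    by (simp add: ys_def split_node_def)
  have "sum_list (map (\<lambda>u'. local_map u' ?y) (split_node (expand_weights (map length xs) u)))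
      = local_map u (map sum_list xs)" if "u \<in> set l" for u
    using ok[OF that] 3(3) length_concat[of xs] by (subst sum_local_map_split_node)
      (auto simp: node_ok_def expand_weights_def length_concat_replicate
        dot_concat_replicate local_map_eq_dot)
  then have sum: "map sum_list ys = map (\<lambda>u. local_map u (map sum_list xs)) l"
    by (simp add: ys_def)
  have conc: "map (\<lambda>u. local_map u ?y) (concat (map split_node ?vs)) = concat ys"
    by (simp add: ys_def map_concat o_def)
  have "set (concat ys) \<subseteq> {0..1}"
    by (auto simp: ys_def split_node_def local_map_def clip_bounds)
  moreover have "length ys = length l" by (simp add: ys_def)
  ultimately have "propagate (clip_layers (map copies ?vs) (l' # ls)) (concat ys)
      = map clip (propagate (l' # ls) (map sum_list ys))"
    using 3(1)[OF refl, of ys] 3(2) len by simp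
  then show ?case using sum conc by (simp add: Let_def)
qed simp

section \<open>Evaluation of the extracted graph\<close>

lemma eval_subst: "eval v (subst s t) = eval (\<lambda>i. eval v (s i)) t"
  by (induction t) auto

text \<open>By \<open>eval_subst\<close>, substituting the formulas of a level amounts to changing
  the valuation, so the induction runs from the inputs to the output with \<open>v\<close>
  arbitrary.\<close>

lemma eval_substitution_graph:
  assumes "layers_ok clip clip m ls" "\<And>i. i < m \<Longrightarrow> 0 \<le> v i \<and> v i \<le> 1"
  shows "eval v (represented_formula (map (map node_formula) ls))
    = hd (propagate ls (map v [0..<m]))"
proof -
  have node: "eval v (node_formula u) = local_map u (map v [0..<m])"
    if "node_ok clip m u" "\<And>i. i < m \<Longrightarrow> 0 \<le> v i \<and> v i \<le> 1" for u m v
    using that eval_node_formula[of u v] by (simp add: node_ok_def local_map_def)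
  from assms show ?thesis unfolding represented_formula_def
  proof (induction clip clip m ls arbitrary: v rule: layers_ok.induct)
    case (2 m l)
    then show ?case by (cases l) (auto simp: node)
  next
    case (3 m l l' ls)
    let ?w = "\<lambda>i. eval v (if i < length (map node_formula l) then map node_formula l ! i else Var i)"
    have w: "?w i = local_map (l ! i) (map v [0..<m])" if "i < length l" for i
      using that 3 by (auto simp: node)
    then have "map ?w [0..<length l] = map (\<lambda>u. local_map u (map v [0..<m])) l"
      by (intro nth_equalityI) simp_all
    moreover have "0 \<le> ?w i \<and> ?w i \<le> 1" if "i < length l" for i
    proof -
      have "act (l ! i) = clip" using 3(2) that by (auto simp: node_ok_def)
      then show ?thesis unfolding w[OF that] by (simp add: local_map_def clip_bounds)
    qed
    ultimately show ?case
      using 3(1)[of ?w] 3(2) by (simp add: subst_level_def eval_subst)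
  qed simp
qed

lemma realization_eq_propagate:
  assumes "layers N \<noteq> []" "last (layers N) \<noteq> []"
  shows "realization N x = hd (propagate (layers N) x)"
proof -
  obtain ls l where ls: "layers N = ls @ [l]" using assms(1) by (metis rev_exhaust)
  then show ?thesis
    using assms(2) by (simp add: realization_def global_map_def level_values_def level_def depth_def
        propagate_def hd_map)
qed

lemma eval_ext:
  assumes N: "N \<in> nondegenerate_rational_networks n" and v: "\<And>i. 0 \<le> v i \<and> v i \<le> 1"
  shows "eval v (represented_formula (ext N)) = realization N (map v [0..<n])"
proof -
  have n: "input_dim N = n" and relu: "relu_network N" and rat: "rational_network N"
    and range: "realization N ` cube n \<subseteq> {0..1}"
    using N by (auto simp: nondegenerate_rational_networks_def)
  have net: "is_network N" using relu by (simp add: relu_network_def)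
  then have ne: "layers N \<noteq> []" "last (layers N) \<noteq> []"
    by (auto simp: is_network_def depth_def width_def level_def last_conv_nth split: if_splits)
  have ok: "layers_ok relu id n (layers N)"
  proof (rule layers_okI[OF ne])
    fix j u assume j: "j < length (layers N)" and u: "u \<in> set (layers N ! j)"
    then have level: "Suc j \<in> {1..depth N}" "u \<in> set (level N (Suc j))"
      by (simp_all add: depth_def level_def)
    have "act u = (if Suc j = length (layers N) then id else relu)"
      using relu level unfolding relu_network_def depth_def by (cases "Suc j = length (layers N)") auto
    moreover have "length (weights u) = width N j"
      using net level unfolding is_network_def by force
    moreover have "set (weights u) \<subseteq> \<rat> \<and> bias u \<in> \<rat>"
      using rat level unfolding rational_network_def by blast
    ultimately show "node_ok (if Suc j = length (layers N) then id else relu)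
        (if j = 0 then n else length (layers N ! (j - 1))) u"
      using n by (simp add: node_ok_def width_def level_def)
  qed
  let ?x = "map v [0..<n]" and ?ks = "replicate n (1 :: nat)"
  let ?cl = "clip_layers ?ks (layers N)"
  \<comment> \<open>Input nodes are not split, so each forms a group of one.\<close>
  let ?xs = "map (\<lambda>y. [y]) ?x"
  have cl: "layers_ok clip clip n ?cl"
    using layers_ok_clip_layers[of relu id ?ks "layers N"] ok by (simp add: sum_list_replicate)
  then have "?cl \<noteq> []" by auto
  then have "represented_formula (ext N) =
      subst_level (map Var [0..<n]) (represented_formula (map (map node_formula) ?cl))"
    by (simp add: represented_formula_def ext_def clip_network_def n)
  moreover have "eval v (if i < length (map Var [0..<n]) then map Var [0..<n] ! i else Var i) = v i" for i
    by simp
  ultimately have "eval v (represented_formula (ext N)) = hd (propagate ?cl ?x)"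
    using eval_substitution_graph[OF cl, of v] v by (simp add: subst_level_def eval_subst)
  also have "propagate ?cl ?x = map clip (propagate (layers N) ?x)"
    using propagate_clip_layers[of ?xs "layers N"] ok v by (simp add: o_def map_replicate_const image_subset_iff)
  also have "hd \<dots> = clip (realization N ?x)"
  proof -
    have "propagate (layers N) ?x \<noteq> []"
      using ne by (metis append_butlast_last_id fold_append comp_apply propagate_def fold_simps map_is_Nil_conv)
    then show ?thesis by (simp add: realization_eq_propagate[OF ne] hd_map)
  qed
  \<comment> \<open>The output clip is inactive because the network maps the cube into the unit
    interval.\<close>
  also have "\<dots> = realization N ?x"
  proof -
    have "?x \<in> cube n" using v by (intro map_upt_in_cube)
    then have "realization N ?x \<in> {0..1}" using range by blast
    then show ?thesis by (simp add: clip_def)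
  qed
  finally show ?thesis .
qed

theorem theorem8:
  fixes n :: nat
  assumes "n \<ge> 1"
  shows "\<forall>N1\<in>nondegenerate_rational_networks n. \<forall>N2\<in>nondegenerate_rational_networks n.
    (\<forall>x\<in>cube n. realization N1 x = realization N2 x) \<longrightarrow> network_derivable DMV N1 N2"
proof (intro ballI impI)
  fix N1 N2
  assume N: "N1 \<in> nondegenerate_rational_networks n" "N2 \<in> nondegenerate_rational_networks n"
    and eq: "\<forall>x\<in>cube n. realization N1 x = realization N2 x"
  show "network_derivable DMV N1 N2"
    unfolding network_derivable_def
  proof (rule DMV_complete)
    fix v :: "nat \<Rightarrow> real" assume v: "\<And>i. 0 \<le> v i \<and> v i \<le> 1"
    then have "map v [0..<n] \<in> cube n" by (intro map_upt_in_cube)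
    then show "eval v (represented_formula (ext N1)) = eval v (represented_formula (ext N2))"
      using eq by (simp add: eval_ext[OF N(1) v] eval_ext[OF N(2) v])
  qed
qed

end
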